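(* Let $n\ge 1$ and let $\mathcal K_{\mathbb{S}^n}$ be the standard $2$-facet colored triangulation of $\mathbb{S}^n$. For each $d\in\mathbb{Z}$ there exists a minimal simplicial degree $d$ self-map of $\mathbb{S}^n$ with respect to $\mathcal K_{\mathbb{S}^n}$; that is, there exist an oriented colored triangulation $\mathcal K$ of $\mathbb{S}^n$ and a simplicial map $f:\mathcal K\to\mathcal K_{\mathbb{S}^n}$ of degree $d$ such that no colored triangulation $\mathcal K'$ of $\mathbb{S}^n$ with fewer facets than $\mathcal K$ admits a simplicial map $\mathcal K'\to\mathcal K_{\mathbb{S}^n}$ of degree $d$.
   Context: All spaces and maps are in the PL category. Simplicial cell complex: a finite collection $K$ of closed balls, with $|K|=\bigcup_{B\in K}B$, such that (i) $|K|$ is the disjoint union of the interiors of the balls in $K$; (ii) for $A,B\in K$, $A\cap B$ is a union of balls of $K$; (iii) for each $h$-ball $A\in K$ the poset $\{B\in K: B\subset A\}$ is isomorphic to the face poset of the standard $h$-simplex. Balls of $K$ are called simplices, maximal ones facets; $K$ is pure $n$-dimensional if all facets have dimension $n$. A colored triangulation of a closed connected PL $n$-manifold $M$ is a pure $n$-dimensional simplicial cell complex $K$ whose $1$-skeleton admits a proper vertex-coloring with $n+1$ colors $0,1,\dots,n$ and such that $|K|$ is PL-homeomorphic to $M$. Simplicial map: $f:K\to L$ is simplicial if for each $A\in K$, $f(A)\in L$ and $\{f(B): B\subset A\}$, ordered by inclusion, equals the poset $\{C\in L: C\subset f(A)\}$. It extends canonically to a continuous map $|f|:|K|\to|L|$.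 Degree: an oriented colored triangulation of a closed connected orientable $n$-manifold is one whose $n$-simplices are coherently oriented. Each $n$-simplex is called positive (orientation $[0,\dots,n]$ given by the order of the colors of its vertices) or negative (orientation $-[0,\dots,n]$), and $n$-simplices sharing an $(n-1)$-face have opposite signs. The generator of $H_n(\mathcal K;\mathbb Z)\cong\mathbb Z$ is the sum of the positive $n$-simplices minus the sum of the negative ones. For a simplicial map $f:\mathcal K_1\to\mathcal K_2$ of oriented colored triangulations, its degree is the integer $d_f$ with $f_*(a)=d_f\,b$, where $a,b$ are these generators of $H_n(\mathcal K_1;\mathbb Z)$ and $H_n(\mathcal K_2;\mathbb Z)$. Standard $2$-facet colored triangulation of $\mathbb{S}^n$: two $n$-simplices, each with vertices labeled $0,1,\dots,n$, glued along all corresponding $(n-1)$-faces so that equally labeled vertices coincide. *)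

theory Defs
  imports
    "HOL-Library.Function_Algebras"
    "HOL-Combinatorics.Permutations"
    "HOL-Analysis.Analysis"
    "HOL-Homology.Homology"
begin

section \<open>The PL category\<close>

text \<open>
  Compact PL spaces are taken to be compact polyhedra (finite unions of polytopes) in the
  space of real sequences. Every finite-dimensional Euclidean space embeds linearly in it, so
  triangulations of unbounded ambient dimension live in one type. A polytope here is the convex
  hull of a finite set, so it lies in a finite-dimensional subspace, on which the product topology
  is the Euclidean one.
\<close>

instantiation "fun" :: (type, real_vector) real_vector
begin

definition "scaleR r f = (\<lambda>x. scaleR r (f x))"

instance
  by standard (auto simp: scaleR_fun_def fun_eq_iff scaleR_add_right scaleR_add_left)

end

lemma scaleR_fun_apply [simp]: "(r *\<^sub>R f) x = r *\<^sub>R f x"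
  by (simp add: scaleR_fun_def)

type_synonym pt = "nat \<Rightarrow> real"

text \<open>The existence of \<open>P\<close> also says that \<open>X\<close> is a compact polyhedron.\<close>

definition pl_map :: "pt set \<Rightarrow> (pt \<Rightarrow> pt) \<Rightarrow> bool" where
  "pl_map X f \<longleftrightarrow>
     continuous_on X f \<and>
     (\<exists>P. finite P \<and> X = \<Union>P \<and>
        (\<forall>p\<in>P. polytope p \<and>
           (\<forall>x\<in>p. \<forall>y\<in>p. \<forall>u\<ge>0. \<forall>v\<ge>0. u + v = 1 \<longrightarrow>
              f (u *\<^sub>R x + v *\<^sub>R y) = u *\<^sub>R f x + v *\<^sub>R f y)))"

definition pl_homeomorphism :: "pt set \<Rightarrow> pt set \<Rightarrow> (pt \<Rightarrow> pt) \<Rightarrow> bool" where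
  "pl_homeomorphism X Y f \<longleftrightarrow> (\<exists>g. homeomorphism X Y f g \<and> pl_map X f \<and> pl_map Y g)"

definition pl_homeomorphic :: "pt set \<Rightarrow> pt set \<Rightarrow> bool" where
  "pl_homeomorphic X Y \<longleftrightarrow> (\<exists>f. pl_homeomorphism X Y f)"

definition pl_ball :: "nat \<Rightarrow> pt set \<Rightarrow> bool" where
  "pl_ball h B \<longleftrightarrow> pl_homeomorphic (standard_simplex h) B"

text \<open>
  The interior of a ball as a manifold with boundary. By invariance of domain all
  parametrizations give the same set; the interior of a \<open>0\<close>-ball is the whole point.
\<close>

definition ball_interior :: "pt set \<Rightarrow> pt set" where
  "ball_interior B =
     {f x | h f x. pl_homeomorphism (standard_simplex h) B f \<and>
                   x \<in> standard_simplex h \<and> (\<forall>i\<le>h. x i > 0)}"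

text \<open>The PL \<open>n\<close>-sphere, as the boundary of the standard \<open>(n+1)\<close>-simplex.\<close>

definition pl_sphere :: "nat \<Rightarrow> pt set" where
  "pl_sphere n = {x \<in> standard_simplex (Suc n). \<exists>i\<le>Suc n. x i = 0}"


section \<open>Simplicial cell complexes and colored triangulations\<close>

definition order_isomorphic :: "'a set set \<Rightarrow> 'b set set \<Rightarrow> bool" where
  "order_isomorphic \<A> \<B> \<longleftrightarrow>
     (\<exists>g. bij_betw g \<A> \<B> \<and> (\<forall>A\<in>\<A>. \<forall>B\<in>\<A>. A \<subseteq> B \<longleftrightarrow> g A \<subseteq> g B))"

text \<open>Balls are nonempty, so the face poset does not include the empty face.\<close>

definition face_poset :: "nat \<Rightarrow> pt set set" where
  "face_poset h = {F. F face_of standard_simplex h \<and> F \<noteq> {}}"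

definition simplicial_cell_complex :: "pt set set \<Rightarrow> bool" where
  "simplicial_cell_complex K \<longleftrightarrow>
     finite K \<and>
     (\<forall>A\<in>K. \<exists>h. pl_ball h A) \<and>
     \<Union>K = (\<Union>A\<in>K. ball_interior A) \<and>
     (\<forall>A\<in>K. \<forall>B\<in>K. A \<noteq> B \<longrightarrow> ball_interior A \<inter> ball_interior B = {}) \<and>
     (\<forall>A\<in>K. \<forall>B\<in>K. \<exists>S\<subseteq>K. A \<inter> B = \<Union>S) \<and>
     (\<forall>A\<in>K. \<forall>h. pl_ball h A \<longrightarrow> order_isomorphic {B \<in> K. B \<subseteq> A} (face_poset h))"

definition facets :: "pt set set \<Rightarrow> pt set set" where
  "facets K = {A \<in> K. \<forall>B\<in>K. A \<subseteq> B \<longrightarrow> A = B}"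

definition pure_dim :: "nat \<Rightarrow> pt set set \<Rightarrow> bool" where
  "pure_dim n K \<longleftrightarrow> (\<forall>A\<in>facets K. pl_ball n A)"

text \<open>Vertices are the \<open>0\<close>-balls of the complex, i.e. singletons rather than points.\<close>

definition vertices :: "pt set set \<Rightarrow> pt set set" where
  "vertices K = {v \<in> K. pl_ball 0 v}"

definition proper_coloring :: "nat \<Rightarrow> pt set set \<Rightarrow> (pt set \<Rightarrow> nat) \<Rightarrow> bool" where
  "proper_coloring n K c \<longleftrightarrow>
     (\<forall>v\<in>vertices K. c v \<le> n) \<and>
     (\<forall>e\<in>K. pl_ball 1 e \<longrightarrow>
        (\<forall>v\<in>vertices K. \<forall>w\<in>vertices K. v \<subseteq> e \<and> w \<subseteq> e \<and> v \<noteq> w \<longrightarrow> c v \<noteq> c w))"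

definition colored_triangulation ::
    "nat \<Rightarrow> pt set \<Rightarrow> pt set set \<Rightarrow> (pt set \<Rightarrow> nat) \<Rightarrow> bool" where
  "colored_triangulation n M K c \<longleftrightarrow>
     simplicial_cell_complex K \<and> pure_dim n K \<and> proper_coloring n K c \<and>
     pl_homeomorphic (\<Union>K) M"

text \<open>
  An orientation is given by the set \<open>P\<close> of positive facets, those oriented by the order of
  their colors. Two \<open>n\<close>-simplices on a common \<open>(n-1)\<close>-face miss the same color \<open>i\<close> there, so
  the color order on each induces \<open>(-1)^i\<close> times the color order on the face. Hence
  coherence means opposite signs.
\<close>

definition oriented_colored_triangulation ::
    "nat \<Rightarrow> pt set \<Rightarrow> pt set set \<Rightarrow> (pt set \<Rightarrow> nat) \<Rightarrow> pt set set \<Rightarrow> bool" where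
  "oriented_colored_triangulation n M K c P \<longleftrightarrow>
     colored_triangulation n M K c \<and> P \<subseteq> facets K \<and>
     (\<forall>A\<in>facets K. \<forall>B\<in>facets K. \<forall>F\<in>K.
        A \<noteq> B \<and> pl_ball (n - 1) F \<and> F \<subseteq> A \<and> F \<subseteq> B \<longrightarrow> (A \<in> P \<longleftrightarrow> B \<notin> P))"


section \<open>Simplicial maps and degree\<close>

definition simplicial_map :: "pt set set \<Rightarrow> pt set set \<Rightarrow> (pt set \<Rightarrow> pt set) \<Rightarrow> bool" where
  "simplicial_map K L f \<longleftrightarrow>
     (\<forall>A\<in>K. f A \<in> L \<and> f ` {B \<in> K. B \<subseteq> A} = {C \<in> L. C \<subseteq> f A})"

text \<open>
  An \<open>n\<close>-dimensional complex has no \<open>(n+1)\<close>-simplices, so its \<open>n\<close>-th simplicial homology is the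
  group of \<open>n\<close>-cycles, and an equation in it is an equation between chains. An
  \<open>n\<close>-simplex in the free abelian group of chains carries the orientation given by its color order.
\<close>

definition fundamental_cycle :: "pt set set \<Rightarrow> pt set set \<Rightarrow> pt set \<Rightarrow>\<^sub>0 int" where
  "fundamental_cycle K P = (\<Sum>A\<in>facets K \<inter> P. frag_of A) - (\<Sum>A\<in>facets K - P. frag_of A)"

definition vertex_of_color :: "pt set set \<Rightarrow> (pt set \<Rightarrow> nat) \<Rightarrow> pt set \<Rightarrow> nat \<Rightarrow> pt set" where
  "vertex_of_color K c A i = (THE v. v \<in> vertices K \<and> v \<subseteq> A \<and> c v = i)"

text \<open>
  The image of \<open>[v0, ..., vn]\<close> is \<open>[f v0, ..., f vn]\<close>. It is zero if \<open>f\<close> collapses the simplex;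
  otherwise reordering the vertices by color in the target contributes the sign of the
  induced permutation of the colors \<open>0, ..., n\<close>. A simplicial map need not preserve colors.
\<close>

definition color_permutation ::
    "nat \<Rightarrow> pt set set \<Rightarrow> (pt set \<Rightarrow> nat) \<Rightarrow> (pt set \<Rightarrow> nat) \<Rightarrow> (pt set \<Rightarrow> pt set) \<Rightarrow> pt set \<Rightarrow> nat \<Rightarrow> nat"
  where
  "color_permutation n K c c' f A = (\<lambda>i. if i \<le> n then c' (f (vertex_of_color K c A i)) else i)"

definition push_chain ::
    "nat \<Rightarrow> pt set set \<Rightarrow> (pt set \<Rightarrow> nat) \<Rightarrow> (pt set \<Rightarrow> nat) \<Rightarrow> (pt set \<Rightarrow> pt set) \<Rightarrow>
     (pt set \<Rightarrow>\<^sub>0 int) \<Rightarrow> pt set \<Rightarrow>\<^sub>0 int" where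
  "push_chain n K c c' f =
     frag_extend (\<lambda>A. if pl_ball n (f A)
                      then frag_cmul (sign (color_permutation n K c c' f A)) (frag_of (f A))
                      else 0)"

definition has_degree ::
    "nat \<Rightarrow> pt set set \<Rightarrow> (pt set \<Rightarrow> nat) \<Rightarrow> pt set set \<Rightarrow>
     pt set set \<Rightarrow> (pt set \<Rightarrow> nat) \<Rightarrow> pt set set \<Rightarrow> (pt set \<Rightarrow> pt set) \<Rightarrow> int \<Rightarrow> bool" where
  "has_degree n K c P L c' Q f d \<longleftrightarrow>
     push_chain n K c c' f (fundamental_cycle K P) = frag_cmul d (fundamental_cycle L Q)"


section \<open>The standard 2-facet colored triangulation of the sphere\<close>

text \<open>
  The first facet is the standard \<open>n\<close>-simplex. The second is the cone over its boundary with
  apex the unit vector \<open>n+1\<close>, so that the underlying space is \<open>pl_sphere n\<close>. They have the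
  same vertices and the same proper faces; the apex is not a vertex of the complex.
\<close>

definition std_cone :: "nat \<Rightarrow> pt set" where
  "std_cone n = {x \<in> standard_simplex (Suc n). \<exists>i\<le>n. x i = 0}"

definition std_complex :: "nat \<Rightarrow> pt set set" where
  "std_complex n = insert (std_cone n) (face_poset n)"

definition std_color :: "pt set \<Rightarrow> nat" where
  "std_color v = (THE i. v = {\<lambda>j. if j = i then 1 else 0})"

definition std_positive :: "nat \<Rightarrow> pt set set" where
  "std_positive n = {standard_simplex n}"

end

theory Submission
  imports Defs
begin

text \<open>
  Among the colored triangulations of the sphere that admit a simplicial map of degree \<open>d\<close>, one has
  the least number of facets as soon as there is any at all, because the natural numbers are
  well-ordered. The content is therefore the existence of a single map of degree \<open>d\<close> for each
  dimension and each integer (\<open>ex_degree\<close>).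

  The target has two facets with the same boundary, and its vertices are the colors. So a
  color-preserving map is determined on all faces below the facets, and it may send each facet
  of the source to either of the two facets of the target, with no compatibility condition. If \<open>p\<close>
  positive and \<open>q\<close> negative facets are sent to the standard simplex and all others to the cone,
  the degree is \<open>p - q\<close> (\<open>has_degree_fold_map\<close>). Hence any oriented colored triangulation of
  the sphere suffices that has as many positive as negative facets, and at least \<open>\<bar>d\<bar>\<close> of each.

  Such triangulations arise as follows. The boundary of the simplex on \<open>0, ..., n+1\<close> is the join of
  a circle with the boundary of the simplex \<open>\<tau>\<close> on \<open>1, ..., n\<close>. The circle is the boundary of the
  triangle whose corners are the vertices \<open>0\<close> and \<open>n+1\<close> and the barycenter of \<open>\<tau>\<close>. Subdivide the
  circle into a polygon with an even number of edges. Each edge, joined with the boundary of \<open>\<tau>\<close>,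
  is a facet: its odd end is the vertex of color \<open>0\<close>, while its even end, joined with the boundary
  of \<open>\<tau>\<close>, is the face opposite to it. Facets of neighboring edges have opposite signs. For \<open>n = 1\<close>
  this is just a polygon with an even number of edges.

  Each facet is the image of the standard simplex under an explicit piecewise linear chart, and two
  charts agree on a face as soon as they meet in its interior. The locale \<open>glued_charts\<close> derives
  all axioms of a colored triangulation from this property. Its only deep ingredient is invariance
  of domain, which shows that the dimension and the interior of a ball do not depend on its
  parametrization.
\<close>


section \<open>Simplices spanned by coordinate vectors\<close>

definition corner :: "nat \<Rightarrow> pt" where
  "corner i = (\<lambda>j. if j = i then 1 else 0)"

text \<open>
  Index sets need not be initial segments, so that every nonempty face of a standard simplex
  is again of this form.
\<close>

definition face_simplex :: "nat set \<Rightarrow> pt set" where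
  "face_simplex J = {x. (\<forall>i. 0 \<le> x i) \<and> (\<forall>i. i \<notin> J \<longrightarrow> x i = 0) \<and> (\<Sum>i\<in>J. x i) = 1}"

definition support :: "pt \<Rightarrow> nat set" where
  "support x = {i. x i \<noteq> 0}"

lemma sum_apply: "(\<Sum>a\<in>A. g a) k = (\<Sum>a\<in>A. g a k)" for g :: "'a \<Rightarrow> pt"
  by (induction A rule: infinite_finite_induct) auto

lemma standard_simplex_eq: "standard_simplex n = face_simplex {..n}"
proof -
  have "x i \<le> 1" if "\<forall>i. 0 \<le> x i" "\<forall>i. i \<notin> {..n} \<longrightarrow> x i = 0" "(\<Sum>i\<le>n. x i) = 1" for x :: pt and i
  proof (cases "i \<le> n")
    case True
    then show ?thesis
      using member_le_sum [of i "{..n}" x] that by auto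
  qed (use that in auto)
  then show ?thesis
    by (auto simp: standard_simplex_def face_simplex_def)
qed

lemma face_simplex_Int:
  assumes "J \<subseteq> J'" "finite J'"
  shows "face_simplex J = face_simplex J' \<inter> {x. \<forall>i. i \<notin> J \<longrightarrow> x i = 0}"
proof -
  have "sum x J = sum x J'" if "\<forall>i. i \<notin> J \<longrightarrow> x i = 0" for x :: pt
    by (rule sum.mono_neutral_left) (use assms that in auto)
  then show ?thesis
    using assms by (auto simp: face_simplex_def)
qed

lemma face_simplex_mono: "J \<subseteq> J' \<Longrightarrow> finite J' \<Longrightarrow> face_simplex J \<subseteq> face_simplex J'"
  using face_simplex_Int by blast

lemma support_subset: "x \<in> face_simplex J \<Longrightarrow> support x \<subseteq> J"
  by (auto simp: face_simplex_def support_def)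

lemma support_nonempty: "x \<in> face_simplex J \<Longrightarrow> support x \<noteq> {}"
  unfolding face_simplex_def support_def using sum.neutral [of J x] by force

lemma mem_face_simplex_iff_support:
  assumes "x \<in> face_simplex J'" "finite J'" "J \<subseteq> J'"
  shows "x \<in> face_simplex J \<longleftrightarrow> support x \<subseteq> J"
  using assms face_simplex_Int [of J J'] by (auto simp: support_def)

lemma corner_in_face_simplex [simp]: "finite J \<Longrightarrow> corner i \<in> face_simplex J \<longleftrightarrow> i \<in> J"
  by (auto simp: corner_def face_simplex_def)

lemma support_corner [simp]: "support (corner i) = {i}"
  by (auto simp: corner_def support_def)

lemma ex_support_eq:
  assumes "finite J" "J \<noteq> {}"
  shows "\<exists>x \<in> face_simplex J. support x = J"
proof (rule bexI [of _ "\<lambda>i. if i \<in> J then 1 / real (card J) else 0"])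
  have "0 < real (card J)"
    using assms by (simp add: card_gt_0_iff)
  then show "(\<lambda>i. if i \<in> J then 1 / real (card J) else 0) \<in> face_simplex J"
    "support (\<lambda>i. if i \<in> J then 1 / real (card J) else 0) = J"
    by (auto simp: face_simplex_def support_def)
qed

lemma face_simplex_singleton [simp]: "face_simplex {i} = {corner i}"
  by (fastforce simp: corner_def face_simplex_def)

lemma convex_face_simplex [intro]: "convex (face_simplex J)"
  unfolding convex_def face_simplex_def
  by (auto simp: sum.distrib simp flip: sum_distrib_left)

lemma face_simplex_expansion:
  assumes "finite J" "x \<in> face_simplex J"
  shows "x = (\<Sum>i\<in>J. x i *\<^sub>R corner i)"
proof
  fix k
  have "(\<Sum>i\<in>J. x i *\<^sub>R corner i) k = (\<Sum>i\<in>J. if k = i then x i else 0)"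
    by (auto simp: sum_apply corner_def intro: sum.cong)
  then show "x k = (\<Sum>i\<in>J. x i *\<^sub>R corner i) k"
    using assms by (auto simp: face_simplex_def)
qed

lemma face_simplex_eq_hull: "finite J \<Longrightarrow> face_simplex J = convex hull (corner ` J)"
proof
  assume J: "finite J"
  show "convex hull corner ` J \<subseteq> face_simplex J"
    by (rule hull_minimal) (use J in auto)
  show "face_simplex J \<subseteq> convex hull corner ` J"
  proof
    fix x assume x: "x \<in> face_simplex J"
    have "(\<Sum>i\<in>J. x i *\<^sub>R corner i) \<in> convex hull corner ` J"
      by (rule convex_sum) (use J x in \<open>auto simp: face_simplex_def hull_inc\<close>)
    then show "x \<in> convex hull corner ` J"
      using face_simplex_expansion [OF J x] by simp
  qed
qed

lemma polytope_face_simplex [intro]: "finite J \<Longrightarrow> polytope (face_simplex J)"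
  by (auto simp: polytope_def face_simplex_eq_hull)

lemma compact_face_simplex:
  assumes "finite J"
  shows "compact (face_simplex J)"
proof -
  obtain n where n: "J \<subseteq> {..n}"
    using assms finite_nat_iff_bounded_le by blast
  have "compact (standard_simplex n)"
    using compactin_standard_simplex [of n] by (simp add: euclidean_product_topology)
  moreover have "closed {x :: pt. \<forall>i. i \<notin> J \<longrightarrow> x i = 0}"
    by (intro closed_Collect_all closed_Collect_imp closed_Collect_eq continuous_on_product_coordinates continuous_on_const) auto
  ultimately show ?thesis
    unfolding face_simplex_Int [OF n finite_atMost] standard_simplex_eq by blast
qed


section \<open>Piecewise linear maps\<close>

text \<open>
  This is the condition on the pieces in \<open>pl_map\<close>.
\<close>

definition affine_on :: "pt set \<Rightarrow> (pt \<Rightarrow> pt) \<Rightarrow> bool" where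
  "affine_on p f \<longleftrightarrow> (\<forall>x\<in>p. \<forall>y\<in>p. \<forall>u\<ge>0. \<forall>v\<ge>0. u + v = 1 \<longrightarrow>
              f (u *\<^sub>R x + v *\<^sub>R y) = u *\<^sub>R f x + v *\<^sub>R f y)"

lemma pl_map_alt:
  "pl_map X f \<longleftrightarrow> continuous_on X f \<and>
     (\<exists>P. finite P \<and> X = \<Union>P \<and> (\<forall>p\<in>P. polytope p \<and> affine_on p f))"
  by (simp add: pl_map_def affine_on_def)

lemma affine_on_subset: "affine_on p f \<Longrightarrow> q \<subseteq> p \<Longrightarrow> affine_on q f"
  unfolding affine_on_def by blast

text \<open>
  The image is the convex hull of the images of the vertices: under a map that is affine on \<open>p\<close>,
  images and preimages of convex sets are convex, which gives one inclusion each.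
\<close>

lemma polytope_affine_image:
  assumes "polytope p" "affine_on p f"
  shows "polytope (f ` p)"
proof -
  obtain V where V: "finite V" "p = convex hull V"
    using assms(1) by (auto simp: polytope_def)
  have "f ` p = convex hull (f ` V)"
  proof
    have "convex (f ` p)"
      unfolding convex_def
    proof (clarify)
      fix x y and u v :: real assume *: "x \<in> p" "y \<in> p" "0 \<le> u" "0 \<le> v" "u + v = 1"
      then have "u *\<^sub>R x + v *\<^sub>R y \<in> p"
        using V(2) convexD [OF convex_convex_hull] by blast
      with * show "u *\<^sub>R f x + v *\<^sub>R f y \<in> f ` p"
        using assms(2) unfolding affine_on_def by (metis imageI)
    qed
    then show "convex hull (f ` V) \<subseteq> f ` p"
      using V(2) by (intro hull_minimal) (auto intro: hull_inc)
    have "convex {x \<in> p. f x \<in> convex hull (f ` V)}"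
    proof (rule convexI)
      fix x y and u v :: real
      assume "x \<in> {x \<in> p. f x \<in> convex hull (f ` V)}" "y \<in> {x \<in> p. f x \<in> convex hull (f ` V)}"
        and uv: "0 \<le> u" "0 \<le> v" "u + v = 1"
      then have *: "x \<in> p" "y \<in> p" "f x \<in> convex hull (f ` V)" "f y \<in> convex hull (f ` V)"
        by auto
      with uv have "u *\<^sub>R x + v *\<^sub>R y \<in> p"
        using V(2) convexD [OF convex_convex_hull] by blast
      moreover have "u *\<^sub>R f x + v *\<^sub>R f y \<in> convex hull (f ` V)"
        using * uv convexD [OF convex_convex_hull] by blast
      moreover have "f (u *\<^sub>R x + v *\<^sub>R y) = u *\<^sub>R f x + v *\<^sub>R f y"
        using * uv assms(2) unfolding affine_on_def by blast
      ultimately show "u *\<^sub>R x + v *\<^sub>R y \<in> {x \<in> p. f x \<in> convex hull (f ` V)}"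
        by simp
    qed
    then have "p \<subseteq> {x \<in> p. f x \<in> convex hull (f ` V)}"
      using V(2) by (subst V(2)) (intro hull_minimal, auto intro: hull_inc)
    then show "f ` p \<subseteq> convex hull (f ` V)"
      by blast
  qed
  then show ?thesis
    using V(1) by (auto simp: polytope_def)
qed

lemma affine_on_inverse:
  assumes "affine_on p f" "convex p" "\<And>x. x \<in> p \<Longrightarrow> g (f x) = x"
  shows "affine_on (f ` p) g"
  unfolding affine_on_def
proof (clarify)
  fix x y and u v :: real assume *: "x \<in> p" "y \<in> p" "0 \<le> u" "0 \<le> v" "u + v = 1"
  then have "u *\<^sub>R x + v *\<^sub>R y \<in> p"
    using convexD [OF assms(2)] by blast
  moreover have "f (u *\<^sub>R x + v *\<^sub>R y) = u *\<^sub>R f x + v *\<^sub>R f y"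
    using * assms(1) unfolding affine_on_def by blast
  ultimately show "g (u *\<^sub>R f x + v *\<^sub>R f y) = u *\<^sub>R g (f x) + v *\<^sub>R g (f y)"
    using * assms(3) by metis
qed

text \<open>
  The inverse of an injective piecewise linear map needs no separate decomposition: it is affine
  on the images of the pieces, and these are polytopes again. Continuity of the inverse is
  compactness.
\<close>

lemma pl_homeomorphism_onto_image:
  assumes pl: "pl_map X f" and inj: "inj_on f X" and X: "compact X"
  shows "pl_homeomorphism X (f ` X) f"
proof -
  have "continuous_on X f"
    using pl by (simp add: pl_map_def)
  with X inj obtain g where g: "homeomorphism X (f ` X) f g"
    using homeomorphism_compact by blast
  obtain P where P: "finite P" "X = \<Union>P" "\<forall>p\<in>P. polytope p \<and> affine_on p f"
    using pl by (auto simp: pl_map_alt)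
  have "polytope (f ` p) \<and> affine_on (f ` p) g" if "p \<in> P" for p
    using that P g by (intro conjI polytope_affine_image affine_on_inverse)
      (auto simp: homeomorphism_def polytope_imp_convex)
  moreover have "f ` X = \<Union>((`) f ` P)"
    using P(2) by auto
  ultimately have "pl_map (f ` X) g"
    unfolding pl_map_alt using g P(1) 
    by (intro conjI exI [of _ "(`) f ` P"]) (auto simp: homeomorphism_def)
  with pl g show ?thesis
    by (auto simp: pl_homeomorphism_def)
qed

text \<open>
  A convex combination of points with nonnegative coordinates has a vanishing coordinate only if all
  points of positive weight have it.
\<close>

lemma hull_Int_face:
  fixes V :: "pt set"
  assumes nonneg: "\<And>v i. v \<in> V \<Longrightarrow> 0 \<le> v i"
  shows "convex hull V \<inter> {x. \<forall>i\<in>A. x i = 0} = convex hull (V \<inter> {x. \<forall>i\<in>A. x i = 0})"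
    (is "_ \<inter> ?Z = convex hull (V \<inter> ?Z)")
proof
  have conv: "convex ?Z"
    by (auto simp: convex_def)
  show "convex hull (V \<inter> ?Z) \<subseteq> convex hull V \<inter> ?Z"
    by (rule hull_minimal) (auto intro: hull_inc convex_Int conv)
  let ?C = "{x. (\<forall>i. 0 \<le> x i) \<and> (x \<in> ?Z \<longrightarrow> x \<in> convex hull (V \<inter> ?Z))}"
  have "convex ?C"
  proof (rule convexI)
    fix x y and u v :: real
    assume x: "x \<in> ?C" and y: "y \<in> ?C" and uv: "0 \<le> u" "0 \<le> v" "u + v = 1"
    show "u *\<^sub>R x + v *\<^sub>R y \<in> ?C"
    proof (cases "u = 0 \<or> v = 0")
      case True
      then show ?thesis
        using x y uv by auto
    next
      case False
      then have pos: "0 < u" "0 < v"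
        using uv by auto
      show ?thesis
      proof (intro CollectI conjI allI impI)
        fix i show "0 \<le> (u *\<^sub>R x + v *\<^sub>R y) i"
          using x y uv by simp
      next
        assume "u *\<^sub>R x + v *\<^sub>R y \<in> ?Z"
        then have *: "u * x i + v * y i = 0" if "i \<in> A" for i
          using that by simp
        have "x i = 0 \<and> y i = 0" if "i \<in> A" for i
        proof -
          have "0 \<le> u * x i" "0 \<le> v * y i"
            using x y uv by auto
          then have "u * x i = 0" "v * y i = 0"
            using * [OF that] by linarith+
          then show ?thesis
            using pos by simp
        qed
        then have "x \<in> convex hull (V \<inter> ?Z)" "y \<in> convex hull (V \<inter> ?Z)"
          using x y by auto
        then show "u *\<^sub>R x + v *\<^sub>R y \<in> convex hull (V \<inter> ?Z)"
          using uv convexD [OF convex_convex_hull] by blast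
      qed
    qed
  qed
  then have "convex hull V \<subseteq> ?C"
    by (intro hull_minimal) (auto intro: hull_inc nonneg)
  then show "convex hull V \<inter> ?Z \<subseteq> convex hull (V \<inter> ?Z)"
    by blast
qed

text \<open>
  The pieces of the decomposition are cut with the face; by \<open>hull_Int_face\<close> the cuts are polytopes.
\<close>

lemma pl_map_face:
  assumes "pl_map (face_simplex J') f" "J \<subseteq> J'" "finite J'"
  shows "pl_map (face_simplex J) f"
proof -
  let ?Z = "{x :: pt. \<forall>i\<in>-J. x i = 0}"
  have eq: "face_simplex J = face_simplex J' \<inter> ?Z"
    using face_simplex_Int [OF assms(2,3)] by auto
  obtain P where P: "finite P" "face_simplex J' = \<Union>P" "\<forall>p\<in>P. polytope p \<and> affine_on p f"
    using assms(1) by (auto simp: pl_map_alt)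
  have "polytope (p \<inter> ?Z)" if "p \<in> P" for p
  proof -
    have "polytope p"
      using P(3) that by blast
    then obtain V where V: "finite V" "p = convex hull V"
      by (auto simp: polytope_def)
    have "V \<subseteq> p"
      unfolding V(2) by (rule hull_subset)
    also have "p \<subseteq> face_simplex J'"
      using P(2) that by blast
    finally have "p \<inter> ?Z = convex hull (V \<inter> ?Z)"
      unfolding V(2) by (intro hull_Int_face) (auto simp: face_simplex_def)
    then show ?thesis
      unfolding polytope_def using V(1) by (intro exI [of _ "V \<inter> ?Z"]) simp
  qed
  moreover have "face_simplex J = \<Union>((\<lambda>p. p \<inter> ?Z) ` P)"
    unfolding eq P(2) by blast
  moreover have "continuous_on (face_simplex J) f"
    by (rule continuous_on_subset [of "face_simplex J'"]) (use assms(1) eq in \<open>auto simp: pl_map_def\<close>)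
  ultimately show ?thesis
    unfolding pl_map_alt using P
    by (intro conjI exI [of _ "(\<lambda>p. p \<inter> ?Z) ` P"]) (auto intro: affine_on_subset)
qed

text \<open>
  Coordinates are pulled back along \<open>e\<close> and set to \<open>0\<close> off \<open>A\<close>. For a bijection \<open>e\<close> from \<open>A\<close> to \<open>B\<close>
  this identifies the simplices spanned by \<open>B\<close> and by \<open>A\<close>.
\<close>

definition relabel :: "(nat \<Rightarrow> nat) \<Rightarrow> nat set \<Rightarrow> pt \<Rightarrow> pt" where
  "relabel e A x = (\<lambda>a. if a \<in> A then x (e a) else 0)"

lemma linear_relabel: "linear (relabel e A)"
  by (rule linearI) (auto simp: relabel_def fun_eq_iff)

lemma continuous_on_relabel [continuous_intros]: "continuous_on S (relabel e A)"
proof (rule continuous_on_coordinatewise_then_product)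
  fix i show "continuous_on S (\<lambda>x. relabel e A x i)"
    by (cases "i \<in> A")
      (auto simp: relabel_def intro: continuous_on_subset [OF continuous_on_product_coordinates])
qed

lemma relabel_face_simplex:
  assumes "bij_betw e A B" and "B' \<subseteq> B" and "x \<in> face_simplex B'"
  shows "relabel e A x \<in> face_simplex {a \<in> A. e a \<in> B'}"
proof -
  have "bij_betw e {a \<in> A. e a \<in> B'} B'"
    using assms(1,2) by (auto simp: bij_betw_def inj_on_def)
  then have "(\<Sum>a | a \<in> A \<and> e a \<in> B'. x (e a)) = sum x B'"
    by (rule sum.reindex_bij_betw)
  moreover have "(\<Sum>a | a \<in> A \<and> e a \<in> B'. relabel e A x a) = (\<Sum>a | a \<in> A \<and> e a \<in> B'. x (e a))"
    by (intro sum.cong) (auto simp: relabel_def)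
  ultimately show ?thesis
    using assms(3) by (auto simp: face_simplex_def relabel_def)
qed

lemma relabel_inverse:
  assumes "bij_betw e A B" "x \<in> face_simplex A"
  shows "relabel e A (relabel (inv_into A e) B x) = x"
  using assms by (auto simp: relabel_def fun_eq_iff face_simplex_def bij_betw_def)

lemma relabel_inverse':
  assumes "bij_betw e A B" "x \<in> face_simplex B"
  shows "relabel (inv_into A e) B (relabel e A x) = x"
  using assms 
  by (auto simp: relabel_def fun_eq_iff face_simplex_def bij_betw_def inv_into_into f_inv_into_f)

lemma relabel_image:
  assumes "bij_betw e A B" "B' \<subseteq> B"
  shows "relabel e A ` face_simplex B' = face_simplex {a \<in> A. e a \<in> B'}"
proof (intro equalityI subsetI)
  fix y assume y: "y \<in> face_simplex {a \<in> A. e a \<in> B'}"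
  have inv: "bij_betw (inv_into A e) B A"
    using assms bij_betw_inv_into by blast
  have eq: "{b \<in> B. inv_into A e b \<in> {a \<in> A. e a \<in> B'}} = B'"
    using assms by (auto simp: bij_betw_def inv_into_into f_inv_into_f)
  have "relabel (inv_into A e) B y \<in> face_simplex B'"
    using relabel_face_simplex [OF inv _ y] eq by auto
  moreover have "y = relabel e A (relabel (inv_into A e) B y)"
  proof -
    have "\<forall>i. i \<notin> A \<longrightarrow> y i = 0"
      using y by (auto simp: face_simplex_def)
    then show ?thesis
      using assms(1) by (auto simp: relabel_def fun_eq_iff bij_betw_def)
  qed
  ultimately show "y \<in> relabel e A ` face_simplex B'"
    by blast
qed (use relabel_face_simplex [OF assms] in auto)

lemma pl_map_relabel:
  assumes e: "bij_betw e A B" and pl: "pl_map (face_simplex A) f"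
  shows "pl_map (face_simplex B) (f \<circ> relabel e A)"
proof -
  obtain P where P: "finite P" "face_simplex A = \<Union>P" "\<forall>p\<in>P. polytope p \<and> affine_on p f"
    using pl by (auto simp: pl_map_alt)
  let ?k = "relabel (inv_into A e) B"
  have inv: "bij_betw (inv_into A e) B A"
    using e bij_betw_inv_into by blast
  have im: "?k ` face_simplex A = face_simplex B" "relabel e A ` face_simplex B = face_simplex A"
  proof -
    have "{b \<in> B. inv_into A e b \<in> A} = B" "{a \<in> A. e a \<in> B} = A"
      using e by (auto simp: bij_betw_def inv_into_into)
    then show "?k ` face_simplex A = face_simplex B" "relabel e A ` face_simplex B = face_simplex A"
      using relabel_image [OF inv order.refl] relabel_image [OF e order.refl] by auto
  qed
  have "affine_on (?k ` p) (f \<circ> relabel e A)" if "p \<in> P" for p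
    unfolding affine_on_def
  proof (clarify)
    fix x y and u v :: real assume *: "x \<in> p" "y \<in> p" "0 \<le> u" "0 \<le> v" "u + v = 1"
    have "relabel e A (?k x) = x" "relabel e A (?k y) = y"
      using * P(2) that e relabel_inverse by blast+
    moreover have "relabel e A (u *\<^sub>R ?k x + v *\<^sub>R ?k y) = u *\<^sub>R relabel e A (?k x) + v *\<^sub>R relabel e A (?k y)"
      using linear_relabel [of e A] by (simp add: linear_add linear_scale)
    moreover have "f (u *\<^sub>R x + v *\<^sub>R y) = u *\<^sub>R f x + v *\<^sub>R f y"
      using * P(3) that unfolding affine_on_def by blast
    ultimately show "(f \<circ> relabel e A) (u *\<^sub>R ?k x + v *\<^sub>R ?k y)
        = u *\<^sub>R (f \<circ> relabel e A) (?k x) + v *\<^sub>R (f \<circ> relabel e A) (?k y)"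
      by simp
  qed
  moreover have "face_simplex B = \<Union>((`) ?k ` P)"
    by (subst im(1) [symmetric]) (auto simp: P(2))
  moreover have "polytope (?k ` p)" if "p \<in> P" for p
    using that P(3) by (simp add: polytope_linear_image linear_relabel)
  moreover have "continuous_on (face_simplex B) (f \<circ> relabel e A)"
    using pl im(2) by (intro continuous_on_compose continuous_on_relabel) (auto simp: pl_map_def)
  ultimately show ?thesis
    unfolding pl_map_alt using P(1)
    by (intro conjI exI [of _ "(`) ?k ` P"]) auto
qed

lemma continuous_on_Min:
  fixes g :: "'i \<Rightarrow> 'a::topological_space \<Rightarrow> real"
  assumes "finite I" "I \<noteq> {}" "\<And>i. i \<in> I \<Longrightarrow> continuous_on S (g i)"
  shows "continuous_on S (\<lambda>x. Min ((\<lambda>i. g i x) ` I))"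
  using assms
proof (induction I rule: finite_ne_induct)
  case (insert a I)
  then have "(\<lambda>x. Min ((\<lambda>i. g i x) ` insert a I)) = (\<lambda>x. min (g a x) (Min ((\<lambda>i. g i x) ` I)))"
    by simp
  with insert show ?case
    by (auto intro!: continuous_on_min)
qed auto

text \<open>
  Where the minimum is attained at a fixed \<open>i\<close>, the map is affine. This region of the simplex is the
  simplex with vertex \<open>i\<close> replaced by the barycenter of the face \<open>I\<close>, hence a polytope.
\<close>

lemma pl_map_add_Min:
  assumes J: "finite J" and I: "I \<subseteq> J" "I \<noteq> {}"
    and lin: "linear T" and cont: "continuous_on (face_simplex J) T"
  shows "pl_map (face_simplex J) (\<lambda>x. T x + Min (x ` I) *\<^sub>R q)"
proof -
  have finI: "finite I" and card: "0 < real (card I)"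
    using J I finite_subset by (auto simp: card_gt_0_iff)
  define S where "S i = {x \<in> face_simplex J. \<forall>k\<in>I. x i \<le> x k}" for i
  define b :: pt where "b = (\<lambda>k. if k \<in> I then 1 / card I else 0)"
  have b: "b \<in> face_simplex J"
    using J I card by (auto simp: b_def face_simplex_def sum.If_cases Int_absorb1)
  have convS: "convex (S i)" for i
  proof -
    have "u * x i + v * y i \<le> u * x k + v * y k"
      if "x i \<le> x k" "y i \<le> y k" "0 \<le> u" "0 \<le> v" for x y :: pt and k u v
      using that by (simp add: add_mono mult_left_mono)
    then have "convex {x :: pt. \<forall>k\<in>I. x i \<le> x k}"
      unfolding convex_def by auto
    moreover have "S i = face_simplex J \<inter> {x :: pt. \<forall>k\<in>I. x i \<le> x k}"
      by (auto simp: S_def)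
    ultimately show ?thesis
      by (auto intro: convex_Int)
  qed
  have poly: "polytope (S i)" if i: "i \<in> I" for i
  proof -
    let ?V = "insert b (corner ` (J - {i}))"
    have "S i = convex hull ?V"
    proof
      show "convex hull ?V \<subseteq> S i"
        by (rule hull_minimal)
          (use b i convS J in \<open>auto simp: S_def b_def corner_def face_simplex_def\<close>)
      show "S i \<subseteq> convex hull ?V"
      proof
        fix x assume x: "x \<in> S i"
        \<comment> \<open>The barycenter \<open>b\<close> takes the place of the vertex \<open>i\<close>: with the weight \<open>card I * x i\<close> it
          contributes \<open>x i\<close> to every coordinate in \<open>I\<close>.\<close>
        define a where "a k = (if k = i then card I * x i else if k \<in> I then x k - x i else x k)" for k
        define y where "y k = (if k = i then b else corner k)" for k
        have a0: "0 \<le> a k" if "k \<in> J" for k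
          using x by (auto simp: a_def S_def face_simplex_def)
        have split: "sum g J = g i + sum g (I - {i}) + sum g (J - I)" for g :: "nat \<Rightarrow> real"
          using i I(1) J finI by (metis (no_types, lifting) sum.remove sum.subset_diff add.commute)
        have suma: "sum a J = 1"
        proof -
          have "sum a (I - {i}) = sum x (I - {i}) - (real (card I) - 1) * x i"
          proof -
            have "sum a (I - {i}) = (\<Sum>k\<in>I - {i}. x k - x i)"
              by (intro sum.cong) (auto simp: a_def)
            moreover have "real (card (I - {i})) = real (card I) - 1"
              using i finI card by (simp add: card_Diff_singleton)
            ultimately show ?thesis
              by (simp add: sum_subtractf)
          qed
          moreover have "sum a (J - I) = sum x (J - I)"
            using i by (intro sum.cong) (auto simp: a_def)
          moreover have "a i = card I * x i"
            by (simp add: a_def)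
          ultimately have "sum a J = sum x J"
            using split [of a] split [of x] by (simp add: algebra_simps)
          then show ?thesis
            using x by (simp add: S_def face_simplex_def)
        qed
        have "x = (\<Sum>k\<in>J. a k *\<^sub>R y k)"
        proof
          fix m
          have "(\<Sum>k\<in>J. a k *\<^sub>R y k) m = a i * b m + (\<Sum>k\<in>J - {i}. a k * corner k m)"
            using i I(1) J
            by (subst sum.remove [of J i]) (auto simp: sum_apply y_def intro!: sum.cong)
          also have "(\<Sum>k\<in>J - {i}. a k * corner k m) = (\<Sum>k\<in>J - {i}. if m = k then a k else 0)"
            by (intro sum.cong) (auto simp: corner_def)
          also have "\<dots> = (if m \<in> J - {i} then a m else 0)"
            using J by simp
          also have "a i * b m + \<dots> = x m"
            using card i I(1) x by (auto simp: a_def b_def S_def face_simplex_def)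
          finally show "x m = (\<Sum>k\<in>J. a k *\<^sub>R y k) m" ..
        qed
        moreover have "(\<Sum>k\<in>J. a k *\<^sub>R y k) \<in> convex hull ?V"
          by (rule convex_sum) (use J a0 suma in \<open>auto simp: y_def intro: hull_inc\<close>)
        ultimately show "x \<in> convex hull ?V"
          by simp
      qed
    qed
    then show ?thesis
      unfolding polytope_def using J by (intro exI [of _ ?V]) simp
  qed
  have minS: "Min (x ` I) = x i" if "x \<in> S i" "i \<in> I" for x i
    using that finI by (intro Min_eqI) (auto simp: S_def)
  have "affine_on (S i) (\<lambda>x. T x + Min (x ` I) *\<^sub>R q)" if i: "i \<in> I" for i
    unfolding affine_on_def
  proof (intro ballI allI impI)
    fix x y and u v :: real assume *: "x \<in> S i" "y \<in> S i" "0 \<le> u" "0 \<le> v" "u + v = 1"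
    then have z: "u *\<^sub>R x + v *\<^sub>R y \<in> S i"
      using convexD [OF convS] by blast
    show "T (u *\<^sub>R x + v *\<^sub>R y) + Min ((u *\<^sub>R x + v *\<^sub>R y) ` I) *\<^sub>R q
        = u *\<^sub>R (T x + Min (x ` I) *\<^sub>R q) + v *\<^sub>R (T y + Min (y ` I) *\<^sub>R q)"
      using lin minS [OF z i] minS [OF *(1) i] minS [OF *(2) i]
      by (simp add: linear_add linear_scale algebra_simps)
  qed
  moreover have "face_simplex J = \<Union>(S ` I)"
  proof
    show "face_simplex J \<subseteq> \<Union>(S ` I)"
    proof
      fix x assume x: "x \<in> face_simplex J"
      have "Min (x ` I) \<in> x ` I"
        using finI I(2) by (intro Min_in) auto
      then obtain i where i: "i \<in> I" "Min (x ` I) = x i"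
        by auto
      have "x i \<le> x k" if "k \<in> I" for k
        using Min_le [of "x ` I" "x k"] finI that i(2) by simp
      then have "x \<in> S i"
        using x by (simp add: S_def)
      then show "x \<in> \<Union>(S ` I)"
        using i(1) by blast
    qed
  qed (auto simp: S_def)
  moreover have "continuous_on (face_simplex J) (\<lambda>x. T x + Min (x ` I) *\<^sub>R q)"
  proof (rule continuous_on_coordinatewise_then_product)
    fix k
    have "continuous_on (face_simplex J) (\<lambda>x. Min ((\<lambda>i. x i) ` I))"
      using finI I(2)
      by (intro continuous_on_Min) (auto intro: continuous_on_subset [OF continuous_on_product_coordinates])
    moreover have "continuous_on (face_simplex J) (\<lambda>x. T x k)"
      using cont by (rule continuous_on_product_then_coordinatewise)
    ultimately show "continuous_on (face_simplex J) (\<lambda>x. (T x + Min (x ` I) *\<^sub>R q) k)"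
      by (auto intro!: continuous_intros)
  qed
  ultimately show ?thesis
    unfolding pl_map_alt using finI poly by (intro conjI exI [of _ "S ` I"]) auto
qed


section \<open>Dimension and interior of a ball\<close>

text \<open>
  Dropping the coordinate \<open>0\<close> embeds an \<open>a\<close>-simplex in \<open>a\<close>-dimensional Euclidean space, with
  open interior. By invariance of domain the image of the interior is open there. So each point of
  the image can be moved a little in every coordinate direction within the target simplex. For
  \<open>b < a\<close> one of these directions leaves the span of the target, and for \<open>b = a\<close> the possible moves
  say that no barycentric coordinate vanishes.
\<close>

lemma simplex_injection_interior:
  assumes cont: "continuous_on (standard_simplex a) f" and inj: "inj_on f (standard_simplex a)"
    and sub: "f ` standard_simplex a \<subseteq> standard_simplex b" and "b \<le> a"
    and x: "x \<in> standard_simplex a" "\<forall>i\<le>a. 0 < x i"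
  shows "a = b" and "\<forall>i\<le>b. 0 < f x i"
proof -
  define E where "E = {y :: pt. \<forall>i\<ge>a. y i = 0}"
  define U where "U = {y \<in> E. (\<forall>i<a. 0 < y i) \<and> (\<Sum>i<a. y i) < 1}"
  \<comment> \<open>\<open>D\<close> drops the coordinate \<open>0\<close>, and \<open>L\<close> restores it from the sum of the others.\<close>
  define L :: "pt \<Rightarrow> pt" where "L y = (\<lambda>i. if i = 0 then 1 - (\<Sum>k<a. y k) else y (i - 1))" for y
  define D :: "pt \<Rightarrow> pt" where "D z = (\<lambda>i. z (Suc i))" for z
  define g where "g y = D (f (L y))" for y
  have Etop: "Euclidean_space a = top_of_set E"
    by (simp add: Euclidean_space_def euclidean_product_topology E_def)
  have contc: "continuous_on S (\<lambda>y. y i)" for S :: "pt set" and i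
    by (rule continuous_on_subset [OF continuous_on_product_coordinates]) auto
  have "openin (top_of_set E) U"
  proof -
    have "open (\<Inter>i<a. {y :: pt. 0 < y i})"
      by (intro open_INT ballI open_Collect_less contc continuous_on_const) auto
    moreover have "open {y :: pt. (\<Sum>i<a. y i) < 1}"
      by (intro open_Collect_less continuous_on_sum contc continuous_on_const)
    moreover have "U = E \<inter> ((\<Inter>i<a. {y :: pt. 0 < y i}) \<inter> {y :: pt. (\<Sum>i<a. y i) < 1})"
      by (auto simp: U_def)
    ultimately show ?thesis
      by (auto simp: openin_open)
  qed
  moreover have L: "L y \<in> standard_simplex a" if "y \<in> U" for y
  proof -
    have "sum (L y) {..a} = L y 0 + (\<Sum>k<a. L y (Suc k))"
      by (rule sum.atMost_shift)
    also have "\<dots> = 1"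
      by (simp add: L_def)
    finally show ?thesis
      using that
      by (auto simp: standard_simplex_eq face_simplex_def L_def U_def E_def not_less
        intro: less_imp_le) (metis Suc_pred less_imp_le not_gr_zero not_less_eq not_less)
  qed
  have fL: "f (L y) \<in> standard_simplex b" if "y \<in> U" for y
    using L [OF that] sub by blast
  have Dinj: "z = z'" if "z \<in> standard_simplex b" "z' \<in> standard_simplex b" "D z = D z'" for z z'
  proof
    have eq: "z (Suc i) = z' (Suc i)" for i
      using that(3) by (metis D_def)
    have "sum z {..b} = 1" "sum z' {..b} = 1"
      using that by (auto simp: standard_simplex_def)
    then have "z 0 = z' 0"
      by (simp add: sum.atMost_shift eq)
    then show "z i = z' i" for i
      using eq by (cases i) auto
  qed
  have "inj_on g U"
  proof (rule inj_onI)
    fix y y' assume *: "y \<in> U" "y' \<in> U" "g y = g y'"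
    then have "f (L y) = f (L y')"
      using Dinj [OF fL fL] unfolding g_def by blast
    then have eq: "L y = L y'"
      using inj_onD [OF inj _ L L] * by blast
    show "y = y'"
    proof
      show "y i = y' i" for i
        using fun_cong [OF eq, of "Suc i"] by (simp add: L_def)
    qed
  qed
  moreover have "continuous_on U g"
  proof -
    have "continuous_on U L"
    proof (rule continuous_on_coordinatewise_then_product)
      show "continuous_on U (\<lambda>y. L y i)" for i
        by (cases "i = 0") (auto simp: L_def intro!: continuous_intros contc)
    qed
    then have "continuous_on U (\<lambda>y. f (L y))"
      by (rule continuous_on_compose2 [OF cont]) (use L in auto)
    then show ?thesis
      unfolding g_def D_def
      by (intro continuous_on_coordinatewise_then_product)
        (rule continuous_on_product_then_coordinatewise)
  qed
  moreover have gE: "g y \<in> E" if "y \<in> U" for y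
  proof -
    show ?thesis
      using \<open>b \<le> a\<close> fL [OF that] by (auto simp: E_def g_def D_def standard_simplex_def)
  qed
  moreover have "U \<subseteq> E"
    by (auto simp: U_def)
  ultimately have opn: "openin (top_of_set E) (g ` U)"
    using invariance_of_domain_Euclidean_space [of a U g]
    by (auto simp: Etop subtopology_subtopology Int_absorb1)
  define y where "y = D x"
  have "(\<Sum>i<a. y i) = 1 - x 0"
    using x(1) sum.atMost_shift [of x a] by (simp add: y_def D_def standard_simplex_def)
  then have y: "y \<in> U" and Ly: "L y = x"
    using x by (auto simp: U_def E_def y_def D_def L_def standard_simplex_def fun_eq_iff)
  let ?z = "g y"
  have perturb: "\<exists>t>0. \<forall>s. \<bar>s\<bar> \<le> t \<longrightarrow> ?z + s *\<^sub>R corner j \<in> g ` U" if "j < a" for j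
  proof -
    obtain W where W: "open W" "g ` U = E \<inter> W"
      using opn by (auto simp: openin_open)
    have "continuous_on UNIV (\<lambda>s :: real. ?z + s *\<^sub>R corner j)"
      by (rule continuous_on_coordinatewise_then_product) (auto intro!: continuous_intros)
    then have "open ((\<lambda>s :: real. ?z + s *\<^sub>R corner j) -` W)"
      using W(1) by (simp add: open_vimage)
    moreover have "0 \<in> (\<lambda>s :: real. ?z + s *\<^sub>R corner j) -` W"
      using W(2) y by auto
    ultimately obtain e where e: "e > 0" "cball 0 e \<subseteq> (\<lambda>s :: real. ?z + s *\<^sub>R corner j) -` W"
      using open_contains_cball by metis
    have "?z + s *\<^sub>R corner j \<in> E" for s
      using gE [OF y] that by (auto simp: E_def corner_def)
    then have "?z + s *\<^sub>R corner j \<in> g ` U" if "\<bar>s\<bar> \<le> e" for s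
      using that e(2) W(2) by (auto simp: subset_iff)
    then show ?thesis
      using e(1) by blast
  qed
  have image_D: "\<exists>w \<in> standard_simplex b. v = D w" if "v \<in> g ` U" for v
    using that fL by (auto simp: g_def)
  show ab: "a = b"
  proof (rule ccontr)
    assume "a \<noteq> b"
    then have "b < a"
      using \<open>b \<le> a\<close> by auto
    then obtain t where t: "t > 0" "?z + t *\<^sub>R corner b \<in> g ` U"
      using perturb by (metis abs_of_pos order_refl)
    then obtain w w' where w: "w \<in> standard_simplex b" "?z + t *\<^sub>R corner b = D w"
      and w': "w' \<in> standard_simplex b" "?z = D w'"
      using image_D y by blast
    have "?z b + t = w (Suc b)"
      using fun_cong [OF w(2), of b] by (auto simp: D_def corner_def)
    moreover have "?z b = w' (Suc b)"
      unfolding w'(2) by (simp add: D_def)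
    ultimately show False
      using t(1) w(1) w'(1) by (simp add: standard_simplex_def)
  qed
  have fx: "f x \<in> standard_simplex b"
    using x(1) sub by auto
  have zfx: "?z = D (f x)"
    by (simp add: g_def Ly)
  show "\<forall>i\<le>b. 0 < f x i"
  proof (intro allI impI)
    fix i assume i: "i \<le> b"
    show "0 < f x i"
    proof (cases i)
      case (Suc j)
      then obtain t where t: "t > 0" "?z + (- t) *\<^sub>R corner j \<in> g ` U"
        using perturb [of j] i ab by (metis Suc_le_eq abs_minus_cancel abs_of_pos order_refl)
      then obtain w where w: "w \<in> standard_simplex b" "?z + (- t) *\<^sub>R corner j = D w"
        using image_D by blast
      have "f x i - t = w i"
        using fun_cong [OF w(2), of j] Suc fun_cong [OF zfx, of j] by (auto simp: D_def corner_def)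
      then have "0 \<le> f x i - t"
        using w(1) by (simp add: standard_simplex_def)
      then show ?thesis
        using t(1) by linarith
    next
      case 0
      show ?thesis
      proof (cases b)
        case 0
        then show ?thesis
          using \<open>i = 0\<close> fx by (simp add: standard_simplex_def)
      next
        case (Suc k)
        then obtain t where t: "t > 0" "?z + t *\<^sub>R corner 0 \<in> g ` U"
          using perturb [of 0] ab by (metis abs_of_pos order_refl zero_less_Suc)
        then obtain w where w: "w \<in> standard_simplex b" "?z + t *\<^sub>R corner 0 = D w"
          using image_D by blast
        have "(\<Sum>i<b. w (Suc i)) = (\<Sum>i<b. f x (Suc i)) + t"
        proof -
          have "w (Suc i) = f x (Suc i) + (if i = 0 then t else 0)" for i
            using fun_cong [OF w(2), of i] fun_cong [OF zfx, of i] by (auto simp: D_def corner_def)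
          then show ?thesis
            using Suc by (simp add: sum.distrib)
        qed
        moreover have "w 0 + (\<Sum>i<b. w (Suc i)) = 1" "f x 0 + (\<Sum>i<b. f x (Suc i)) = 1"
          using w(1) fx by (simp_all add: standard_simplex_def flip: sum.atMost_shift)
        moreover have "0 \<le> w 0"
          using w(1) by (simp add: standard_simplex_def)
        ultimately show ?thesis
          using t(1) unfolding \<open>i = 0\<close> by linarith
      qed
    qed
  qed
qed

lemma homeomorphic_simplices_interior:
  assumes "homeomorphism (standard_simplex a) B f g" "homeomorphism (standard_simplex b) B f' g'"
    and "b \<le> a" and "x \<in> standard_simplex a" "\<forall>i\<le>a. 0 < x i"
  shows "a = b" and "\<forall>i\<le>b. 0 < g' (f x) i"
proof -
  have "continuous_on (standard_simplex a) (g' \<circ> f)"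
    using assms(1,2) by (intro continuous_on_compose) (auto simp: homeomorphism_def)
  moreover have "inj_on (g' \<circ> f) (standard_simplex a)"
    using assms(1,2) unfolding homeomorphism_def inj_on_def by (metis comp_apply imageI)
  moreover have "(g' \<circ> f) ` standard_simplex a \<subseteq> standard_simplex b"
    using assms(1,2) by (auto simp: homeomorphism_def)
  ultimately show "a = b" "\<forall>i\<le>b. 0 < g' (f x) i"
    using simplex_injection_interior [of a "g' \<circ> f" b x] assms(3-5) by auto
qed

lemma pl_ball_dimension_unique:
  assumes "pl_ball a B" "pl_ball b B"
  shows "a = b"
proof -
  obtain f g f' g' where "homeomorphism (standard_simplex a) B f g"
    "homeomorphism (standard_simplex b) B f' g'"
    using assms by (auto simp: pl_ball_def pl_homeomorphic_def pl_homeomorphism_def)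
  moreover have "\<exists>x \<in> standard_simplex c. \<forall>i\<le>c. 0 < x i" for c
  proof -
    obtain x where "x \<in> face_simplex {..c}" "support x = {..c}"
      using ex_support_eq [of "{..c}"] by auto
    then show ?thesis
      unfolding standard_simplex_eq by (intro bexI [of _ x]) (auto simp: face_simplex_def support_def less_le)
  qed
  ultimately show ?thesis
    using homeomorphic_simplices_interior(1) by (metis nle_le)
qed

lemma ball_interior_eq:
  assumes "pl_homeomorphism (standard_simplex h) B f"
  shows "ball_interior B = f ` {x \<in> standard_simplex h. \<forall>i\<le>h. 0 < x i}"
proof
  show "f ` {x \<in> standard_simplex h. \<forall>i\<le>h. 0 < x i} \<subseteq> ball_interior B"
    using assms by (auto simp: ball_interior_def)
  obtain g where g: "homeomorphism (standard_simplex h) B f g"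
    using assms by (auto simp: pl_homeomorphism_def)
  show "ball_interior B \<subseteq> f ` {x \<in> standard_simplex h. \<forall>i\<le>h. 0 < x i}"
  proof
    fix z assume "z \<in> ball_interior B"
    then obtain k f' x where f': "pl_homeomorphism (standard_simplex k) B f'"
      and x: "x \<in> standard_simplex k" "\<forall>i\<le>k. 0 < x i" and z: "z = f' x"
      by (auto simp: ball_interior_def)
    have "k = h"
      using assms f' pl_ball_dimension_unique by (auto simp: pl_ball_def pl_homeomorphic_def)
    obtain g' where "homeomorphism (standard_simplex k) B f' g'"
      using f' by (auto simp: pl_homeomorphism_def)
    then have "\<forall>i\<le>h. 0 < g z i" "z \<in> B"
      using homeomorphic_simplices_interior(2) [of k B f' g' h f g x] g x z \<open>k = h\<close>
      by (auto simp: homeomorphism_def)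
    moreover have "g z \<in> standard_simplex h" "f (g z) = z"
      using g \<open>z \<in> B\<close> by (auto simp: homeomorphism_def)
    ultimately show "z \<in> f ` {x \<in> standard_simplex h. \<forall>i\<le>h. 0 < x i}"
      by (intro image_eqI [of z f "g z"]) auto
  qed
qed


section \<open>Faces of the standard simplex\<close>

lemma face_simplex_subset_iff:
  assumes "finite A" "finite B"
  shows "face_simplex A \<subseteq> face_simplex B \<longleftrightarrow> A \<subseteq> B"
proof
  assume "face_simplex A \<subseteq> face_simplex B"
  then show "A \<subseteq> B"
    using corner_in_face_simplex assms by (metis subsetD subsetI)
qed (use assms face_simplex_mono in auto)

lemma face_simplex_face_of:
  assumes "J \<subseteq> J'" "finite J'"
  shows "face_simplex J face_of face_simplex J'"
  unfolding face_of_def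
proof (intro conjI ballI impI)
  show "face_simplex J \<subseteq> face_simplex J'"
    using assms by (rule face_simplex_mono)
  fix a b x
  assume *: "a \<in> face_simplex J'" "b \<in> face_simplex J'" "x \<in> face_simplex J" "x \<in> open_segment a b"
  then obtain u where u: "0 < u" "u < 1" "x = (1 - u) *\<^sub>R a + u *\<^sub>R b"
    by (auto simp: in_segment)
  have "a i = 0 \<and> b i = 0" if "i \<notin> J" for i
  proof -
    have "(1 - u) * a i + u * b i = 0"
      using *(3) that u(3) by (auto simp: face_simplex_def)
    moreover have "0 \<le> (1 - u) * a i" "0 \<le> u * b i"
      using * u by (auto simp: face_simplex_def)
    ultimately have "(1 - u) * a i = 0" "u * b i = 0"
      by linarith+
    then show ?thesis
      using u by simp
  qed
  then show "a \<in> face_simplex J" "b \<in> face_simplex J"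
    using * face_simplex_Int [OF assms] by auto
qed auto

text \<open>
  A point \<open>x\<close> of maximal support in a face \<open>F\<close> has every other point of \<open>F\<close> supported in its own support
  \<open>J\<close>, since midpoints have the union of the supports. Conversely every point spanned by \<open>J\<close>
  is one end of a segment through \<open>x\<close> within the simplex, so it belongs to the face.
\<close>

lemma face_of_face_simplex:
  assumes F: "F face_of face_simplex J'" "F \<noteq> {}" and J': "finite J'"
  obtains J where "J \<noteq> {}" "J \<subseteq> J'" "F = face_simplex J"
proof -
  have sub: "F \<subseteq> face_simplex J'" and conv: "convex F"
    and ends: "\<And>a b x. a \<in> face_simplex J' \<Longrightarrow> b \<in> face_simplex J' \<Longrightarrow> x \<in> F \<Longrightarrow>
      x \<in> open_segment a b \<Longrightarrow> a \<in> F"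
    using F(1) by (auto simp: face_of_def)
  have "card (support z) \<le> card J'" if "z \<in> F" for z
    using that sub support_subset J' by (intro card_mono) blast+
  then obtain x where x: "x \<in> F" and max: "\<And>y. y \<in> F \<Longrightarrow> card (support y) \<le> card (support x)"
    using ex_has_greatest_nat [of "\<lambda>z. z \<in> F" _ "\<lambda>z. card (support z)" "Suc (card J')"] F(2)
    by (metis ex_in_conv less_Suc_eq_le)
  define J where "J = support x"
  have xJ': "x \<in> face_simplex J'" and JJ': "J \<subseteq> J'" and finJ: "finite J" and neJ: "J \<noteq> {}"
    using x sub support_subset [of x J'] J' finite_subset support_nonempty [of x J']
    by (auto simp: J_def)
  have xpos: "0 < x i" if "i \<in> J" for i
    using that xJ' by (auto simp: J_def support_def face_simplex_def less_le)
  have "support y \<subseteq> J" if y: "y \<in> F" for y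
  proof -
    let ?z = "(1/2) *\<^sub>R x + (1/2) *\<^sub>R y"
    have z: "?z \<in> F"
      using conv x y by (intro convexD) auto
    have "y \<in> face_simplex J'"
      using y sub by auto
    then have "0 \<le> x i" "0 \<le> y i" for i
      using xJ' by (auto simp: face_simplex_def)
    then have supz: "support ?z = support x \<union> support y"
      by (force simp: support_def add_nonneg_eq_0_iff)
    have "finite (support ?z)"
      using z sub support_subset J' finite_subset by (meson subsetD)
    then have "support x = support ?z"
      using max [OF z] supz by (intro card_seteq) auto
    then show ?thesis
      using supz by (auto simp: J_def)
  qed
  then have "F \<subseteq> face_simplex J"
    using sub mem_face_simplex_iff_support [OF _ J' JJ'] by auto
  moreover have "face_simplex J \<subseteq> F"
  proof
    fix y assume y: "y \<in> face_simplex J"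
    show "y \<in> F"
    proof (cases "y = x")
      case False
      \<comment> \<open>As \<open>y i \<le> 1\<close>, moving \<open>x\<close> away from \<open>y\<close> by this factor keeps all coordinates nonnegative.\<close>
      define \<epsilon> where "\<epsilon> = Min (x ` J)"
      have \<epsilon>: "0 < \<epsilon>" "\<And>i. i \<in> J \<Longrightarrow> \<epsilon> \<le> x i"
        using finJ neJ xpos by (auto simp: \<epsilon>_def)
      define z where "z = x + \<epsilon> *\<^sub>R (x - y)"
      have yJ': "y \<in> face_simplex J'"
        using y face_simplex_mono [OF JJ' J'] by auto
      have "0 \<le> z i" for i
      proof (cases "i \<in> J")
        case True
        have "y i \<le> 1"
          using member_le_sum [of i J y] True y finJ by (auto simp: face_simplex_def)
        then have "\<epsilon> * y i \<le> \<epsilon>"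
          using \<epsilon>(1) by (simp add: mult_left_le)
        then have "\<epsilon> * y i \<le> x i"
          using \<epsilon>(2) [OF True] by linarith
        moreover have "0 \<le> \<epsilon> * x i"
          using \<epsilon>(1) xpos [OF True] by simp
        ultimately show ?thesis
          by (simp add: z_def algebra_simps)
      next
        case False
        then show ?thesis
          using y by (auto simp: z_def J_def support_def face_simplex_def)
      qed
      moreover have "sum z J' = 1"
        using xJ' yJ' by (simp add: z_def face_simplex_def sum.distrib sum_subtractf flip: sum_distrib_left)
      ultimately have z: "z \<in> face_simplex J'"
        using xJ' yJ' by (auto simp: face_simplex_def z_def)
      have "x \<in> open_segment y z"
        unfolding in_segment
      proof (intro conjI exI [of _ "1 / (1 + \<epsilon>)"])
        show "y \<noteq> z"
        proof
          assume "y = z"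
          then have "(1 + \<epsilon>) *\<^sub>R (x - y) = 0"
            by (simp add: z_def algebra_simps)
          then show False
            using False \<epsilon>(1) by simp
        qed
        have "(1 - 1 / (1 + \<epsilon>)) * y i + (1 / (1 + \<epsilon>)) * z i = x i" for i
        proof -
          have "(1 + \<epsilon>) * x i = \<epsilon> * y i + z i"
            by (simp add: z_def algebra_simps)
          then have "x i = (\<epsilon> * y i + z i) / (1 + \<epsilon>)"
            using \<epsilon>(1) by (simp add: field_simps)
          moreover have "1 - 1 / (1 + \<epsilon>) = \<epsilon> / (1 + \<epsilon>)"
            using \<epsilon>(1) by (simp add: field_simps)
          ultimately show ?thesis
            by (simp add: add_divide_distrib)
        qed
        then show "x = (1 - 1 / (1 + \<epsilon>)) *\<^sub>R y + (1 / (1 + \<epsilon>)) *\<^sub>R z"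
          by (simp add: fun_eq_iff)
      qed (use \<epsilon>(1) in auto)
      then show ?thesis
        using ends [OF yJ' z x] by simp
    qed (use x in simp)
  qed
  ultimately have "F = face_simplex J" ..
  then show ?thesis
    using that neJ JJ' by blast
qed

lemma face_poset_eq: "face_poset h = face_simplex ` {J. J \<noteq> {} \<and> J \<subseteq> {..h}}"
proof (intro equalityI subsetI)
  fix F assume "F \<in> face_poset h"
  then show "F \<in> face_simplex ` {J. J \<noteq> {} \<and> J \<subseteq> {..h}}"
    using face_of_face_simplex [of F "{..h}"] unfolding face_poset_def standard_simplex_eq by blast
next
  fix F assume "F \<in> face_simplex ` {J. J \<noteq> {} \<and> J \<subseteq> {..h}}"
  then obtain J where J: "J \<noteq> {}" "J \<subseteq> {..h}" "F = face_simplex J"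
    by blast
  then obtain i where "i \<in> J"
    by blast
  then have "corner i \<in> F"
    using J finite_subset [OF J(2)] by simp
  then show "F \<in> face_poset h"
    using J face_simplex_face_of [of J "{..h}"] by (auto simp: face_poset_def standard_simplex_eq)
qed

text \<open>
  Two families indexed by the same set are isomorphic if the inclusions agree; the indexing need not be
  injective.
\<close>

lemma order_isomorphic_images:
  assumes "\<And>A B. A \<in> X \<Longrightarrow> B \<in> X \<Longrightarrow> F A \<subseteq> F B \<longleftrightarrow> G A \<subseteq> G B"
  shows "order_isomorphic (F ` X) (G ` X)"
proof -
  have eq: "F A = F B \<longleftrightarrow> G A = G B" if "A \<in> X" "B \<in> X" for A B
    using assms [OF that] assms [OF that(2,1)] by (simp add: set_eq_subset)
  define g where "g C = G (inv_into X F C)" for C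
  have g: "g (F A) = G A" if "A \<in> X" for A
    using that eq inv_into_into [of "F A" F X] f_inv_into_f [of "F A" F X] by (auto simp: g_def)
  then have "bij_betw g (F ` X) (G ` X)"
    using eq by (auto simp: bij_betw_def inj_on_def image_image)
  then show ?thesis
    unfolding order_isomorphic_def using assms g by (intro exI [of _ g]) auto
qed


section \<open>Images of faces as cells\<close>

locale simplex_chart =
  fixes n :: nat and f :: "pt \<Rightarrow> pt"
  assumes pl: "pl_map (standard_simplex n) f" and inj: "inj_on f (standard_simplex n)"
begin

lemma cell_parametrization:
  assumes "J \<subseteq> {..n}" "J \<noteq> {}"
  obtains e where "bij_betw e J {..card J - 1}"
    "pl_homeomorphism (standard_simplex (card J - 1)) (f ` face_simplex J) (f \<circ> relabel e J)"
proof -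
  have finJ: "finite J"
    using assms finite_subset by blast
  have "{..card J - 1} = {0..<card J}"
  proof -
    have "0 < card J"
      using assms(2) finJ by (simp add: card_gt_0_iff)
    then show ?thesis
      by auto
  qed
  then obtain e where e: "bij_betw e J {..card J - 1}"
    using ex_bij_betw_finite_nat [OF finJ] by auto
  let ?h = "card J - 1"
  have sub: "face_simplex J \<subseteq> standard_simplex n"
    unfolding standard_simplex_eq using assms by (intro face_simplex_mono) auto
  have im: "relabel e J ` face_simplex {..?h} = face_simplex J"
  proof -
    have "{a \<in> J. e a \<in> {..?h}} = J"
      using e by (auto simp: bij_betw_def)
    then show ?thesis
      using relabel_image [OF e order.refl] by simp
  qed
  have "pl_map (face_simplex {..?h}) (f \<circ> relabel e J)"
    using pl assms(1) unfolding standard_simplex_eq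
    by (intro pl_map_relabel [OF e]) (rule pl_map_face [of "{..n}"], auto)
  moreover have "inj_on (f \<circ> relabel e J) (face_simplex {..?h})"
  proof (rule comp_inj_on)
    show "inj_on (relabel e J) (face_simplex {..?h})"
      by (rule inj_on_inverseI) (rule relabel_inverse' [OF e])
    show "inj_on f (relabel e J ` face_simplex {..?h})"
      unfolding im using inj sub by (rule inj_on_subset)
  qed
  ultimately have "pl_homeomorphism (face_simplex {..?h})
      ((f \<circ> relabel e J) ` face_simplex {..?h}) (f \<circ> relabel e J)"
    by (rule pl_homeomorphism_onto_image) (auto intro: compact_face_simplex)
  then show ?thesis
    using that [OF e] unfolding standard_simplex_eq image_comp [symmetric] im by blast
qed

lemma pl_ball_cell:
  assumes "J \<subseteq> {..n}" "J \<noteq> {}"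
  shows "pl_ball (card J - 1) (f ` face_simplex J)"
  using cell_parametrization [OF assms] by (auto simp: pl_ball_def pl_homeomorphic_def)

lemma ball_interior_cell:
  assumes "J \<subseteq> {..n}" "J \<noteq> {}"
  shows "ball_interior (f ` face_simplex J) = f ` {x \<in> face_simplex J. support x = J}"
proof -
  obtain e where e: "bij_betw e J {..card J - 1}"
    "pl_homeomorphism (standard_simplex (card J - 1)) (f ` face_simplex J) (f \<circ> relabel e J)"
    using cell_parametrization [OF assms] .
  let ?h = "card J - 1"
  have eJ: "e a \<le> ?h" if "a \<in> J" for a
    using e(1) that by (auto simp: bij_betw_def)
  then have *: "{a \<in> J. e a \<in> {..?h}} = J"
    by auto
  have "relabel e J ` {x \<in> face_simplex {..?h}. \<forall>i\<le>?h. 0 < x i} = {x \<in> face_simplex J. support x = J}"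
  proof (intro equalityI subsetI)
    fix y assume "y \<in> relabel e J ` {x \<in> face_simplex {..?h}. \<forall>i\<le>?h. 0 < x i}"
    then obtain x where x: "x \<in> face_simplex {..?h}" "\<forall>i\<le>?h. 0 < x i" "y = relabel e J x"
      by blast
    then have "y \<in> face_simplex J"
      using relabel_face_simplex [OF e(1) order.refl x(1)] * by simp
    moreover have "support y = J"
      using x(2,3) eJ by (force simp: support_def relabel_def)
    ultimately show "y \<in> {x \<in> face_simplex J. support x = J}"
      by simp
  next
    fix y assume y: "y \<in> {x \<in> face_simplex J. support x = J}"
    then have "y \<in> relabel e J ` face_simplex {..?h}"
      using relabel_image [OF e(1) order.refl] * by simp
    then obtain x where x: "x \<in> face_simplex {..?h}" "y = relabel e J x"
      by blast
    have "0 < x i" if "i \<le> ?h" for i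
    proof -
      have "i \<in> e ` J"
        using that e(1) by (simp add: bij_betw_def)
      then obtain a where a: "a \<in> J" "e a = i"
        by blast
      then have "a \<in> support y"
        using y by simp
      then have "x i \<noteq> 0"
        using a by (simp add: support_def relabel_def x(2))
      then show ?thesis
        using x(1) by (simp add: face_simplex_def less_le)
    qed
    then show "y \<in> relabel e J ` {x \<in> face_simplex {..?h}. \<forall>i\<le>?h. 0 < x i}"
      using x by blast
  qed
  then show ?thesis
    using ball_interior_eq [OF e(2)] unfolding standard_simplex_eq image_comp [symmetric] by simp
qed

lemma cell_subset_iff:
  assumes "A \<subseteq> {..n}" "B \<subseteq> {..n}"
  shows "f ` face_simplex A \<subseteq> f ` face_simplex B \<longleftrightarrow> A \<subseteq> B"
proof -
  have fin: "finite A" "finite B"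
    using assms finite_subset by blast+
  have "face_simplex A \<subseteq> standard_simplex n" "face_simplex B \<subseteq> standard_simplex n"
    unfolding standard_simplex_eq using assms by (simp_all add: face_simplex_mono)
  then have "f ` face_simplex A \<subseteq> f ` face_simplex B \<longleftrightarrow> face_simplex A \<subseteq> face_simplex B"
    using inj_on_image_subset_iff [OF inj] by blast
  then show ?thesis
    by (simp add: face_simplex_subset_iff fin)
qed

text \<open>
  Both posets are copies of the nonempty subsets of \<open>J\<close>.
\<close>

lemma order_isomorphic_cell:
  assumes "J \<subseteq> {..n}" "J \<noteq> {}"
  shows "order_isomorphic ((\<lambda>A. f ` face_simplex A) ` {A. A \<noteq> {} \<and> A \<subseteq> J}) (face_poset (card J - 1))"
proof -
  obtain e where e: "bij_betw e J {..card J - 1}"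
    using cell_parametrization [OF assms] .
  let ?X = "{A. A \<noteq> {} \<and> A \<subseteq> J}"
  have "face_poset (card J - 1) = (\<lambda>A. face_simplex (e ` A)) ` ?X"
  proof -
    have "(`) e ` ?X = {A. A \<noteq> {} \<and> A \<subseteq> {..card J - 1}}"
    proof (intro equalityI subsetI)
      fix A assume "A \<in> {A. A \<noteq> {} \<and> A \<subseteq> {..card J - 1}}"
      then have A: "A \<noteq> {}" "A \<subseteq> e ` J"
        using e by (auto simp: bij_betw_def)
      then obtain A' where "A' \<subseteq> J" "A = e ` A'"
        by (auto simp: subset_image_iff)
      then show "A \<in> (`) e ` ?X"
        using A(1) by auto
    qed (use e in \<open>auto simp: bij_betw_def\<close>)
    then show ?thesis
      unfolding face_poset_eq by (simp add: image_image [symmetric])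
  qed
  moreover have "f ` face_simplex A \<subseteq> f ` face_simplex B
      \<longleftrightarrow> face_simplex (e ` A) \<subseteq> face_simplex (e ` B)" if "A \<in> ?X" "B \<in> ?X" for A B
  proof -
    have An: "A \<subseteq> {..n}" "B \<subseteq> {..n}"
      using that assms by auto
    then have "finite (e ` A)" "finite (e ` B)"
      using finite_subset [of _ "{..n}"] by auto
    moreover have "e ` A \<subseteq> e ` B \<longleftrightarrow> A \<subseteq> B"
      using e that by (intro inj_on_image_subset_iff [of e J]) (auto simp: bij_betw_def)
    ultimately show ?thesis
      using cell_subset_iff [OF An] by (simp add: face_simplex_subset_iff)
  qed
  ultimately show ?thesis
    by (simp only: order_isomorphic_images)
qed

end


section \<open>Colored complexes glued from charts\<close>

text \<open>
  The assumptions say that equal points of two charts have equal barycentric coordinates, and that the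
  charts then agree on the whole face that contains the point in its interior; two different charts
  never share an interior point of a facet. Thus cells are glued along faces with the same
  vertex labels, which makes the label of a vertex a proper coloring.
\<close>

locale glued_charts =
  fixes n :: nat and I :: "'i set" and \<phi> :: "'i \<Rightarrow> pt \<Rightarrow> pt"
  assumes finite_I: "finite I"
    and pl: "\<And>i. i \<in> I \<Longrightarrow> pl_map (standard_simplex n) (\<phi> i)"
    and glue_point: "\<And>i k x y. i \<in> I \<Longrightarrow> k \<in> I \<Longrightarrow> x \<in> standard_simplex n \<Longrightarrow>
      y \<in> standard_simplex n \<Longrightarrow> \<phi> i x = \<phi> k y \<Longrightarrow> x = y"
    and glue_face: "\<And>i k x z. i \<in> I \<Longrightarrow> k \<in> I \<Longrightarrow> x \<in> standard_simplex n \<Longrightarrow>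
      \<phi> i x = \<phi> k x \<Longrightarrow> z \<in> face_simplex (support x) \<Longrightarrow> \<phi> i z = \<phi> k z"
    and glue_interior: "\<And>i k x. i \<in> I \<Longrightarrow> k \<in> I \<Longrightarrow> x \<in> standard_simplex n \<Longrightarrow>
      support x = {..n} \<Longrightarrow> \<phi> i x = \<phi> k x \<Longrightarrow> i = k"
begin

definition cell :: "'i \<Rightarrow> nat set \<Rightarrow> pt set" where
  "cell i J = \<phi> i ` face_simplex J"

definition faces :: "nat set \<Rightarrow> nat set set" where
  "faces J = {A. A \<noteq> {} \<and> A \<subseteq> J}"

definition cells :: "pt set set" where
  "cells = {cell i J | i J. i \<in> I \<and> J \<in> faces {..n}}"

definition color :: "pt set \<Rightarrow> nat" where
  "color v = (THE a. a \<le> n \<and> (\<exists>i\<in>I. v = cell i {a}))"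

lemma simplex_chart: "i \<in> I \<Longrightarrow> simplex_chart n (\<phi> i)"
  by unfold_locales (auto intro: pl inj_onI glue_point)

lemma facesD: "J \<in> faces {..n} \<Longrightarrow> J \<noteq> {} \<and> J \<subseteq> {..n} \<and> finite J"
  using finite_subset by (auto simp: faces_def)

lemma faces_mono: "A \<in> faces J \<Longrightarrow> J \<in> faces J' \<Longrightarrow> A \<in> faces J'"
  by (auto simp: faces_def)

lemma face_subset_simplex: "J \<in> faces {..n} \<Longrightarrow> face_simplex J \<subseteq> standard_simplex n"
  unfolding standard_simplex_eq by (rule face_simplex_mono) (auto simp: faces_def)

lemma ball_interior_cell:
  assumes "i \<in> I" "J \<in> faces {..n}"
  shows "ball_interior (cell i J) = \<phi> i ` {x \<in> face_simplex J. support x = J}"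
  unfolding cell_def
  by (rule simplex_chart.ball_interior_cell) (use assms simplex_chart in \<open>auto simp: faces_def\<close>)

lemma pl_ball_cell:
  assumes "i \<in> I" "J \<in> faces {..n}"
  shows "pl_ball (card J - 1) (cell i J)"
  unfolding cell_def
  by (rule simplex_chart.pl_ball_cell) (use assms simplex_chart in \<open>auto simp: faces_def\<close>)

lemma pl_ball_cell_iff:
  assumes "i \<in> I" "J \<in> faces {..n}"
  shows "pl_ball h (cell i J) \<longleftrightarrow> h = card J - 1"
  using pl_ball_cell [OF assms] pl_ball_dimension_unique by metis

lemma cell_subset_iff:
  assumes "i \<in> I" "A \<in> faces {..n}" "B \<in> faces {..n}"
  shows "cell i A \<subseteq> cell i B \<longleftrightarrow> A \<subseteq> B"
  unfolding cell_def
  by (rule simplex_chart.cell_subset_iff) (use assms simplex_chart in \<open>auto simp: faces_def\<close>)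

text \<open>
  A cell is the union of the interiors of its faces, the face being read off from the support.
\<close>

lemma point_in_open_cell:
  assumes "i \<in> I" "J \<in> faces {..n}" "p \<in> cell i J"
  obtains x where "x \<in> face_simplex J" "p = \<phi> i x" "support x \<in> faces J"
    "x \<in> face_simplex (support x)" "p \<in> ball_interior (cell i (support x))"
proof -
  obtain x where x: "x \<in> face_simplex J" "p = \<phi> i x"
    using assms(3) by (auto simp: cell_def)
  have supp: "support x \<in> faces J"
    using x(1) support_subset support_nonempty by (auto simp: faces_def)
  have "x \<in> face_simplex (support x)"
    using x(1) supp facesD [OF assms(2)]
    by (subst mem_face_simplex_iff_support [of x J]) (auto simp: faces_def)
  then show ?thesis
    using that x supp ball_interior_cell [OF assms(1) faces_mono [OF supp assms(2)]] by blast
qed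

text \<open>
  The gluing assumptions compare points; this is their consequence for cells, on which the
  statements about subcells and intersections rest.
\<close>

lemma cells_eq_if_interiors_meet:
  assumes "i \<in> I" "A \<in> faces {..n}" "k \<in> I" "B \<in> faces {..n}"
    and "x \<in> face_simplex A" "support x = A" "y \<in> face_simplex B" "support y = B" "\<phi> i x = \<phi> k y"
  shows "A = B" "cell i A = cell k B"
proof -
  have sub: "x \<in> standard_simplex n" "y \<in> standard_simplex n"
    using assms face_subset_simplex by blast+
  have "x = y"
    using glue_point [OF assms(1,3) sub assms(9)] .
  then show AB: "A = B"
    using assms by simp
  have "\<phi> i z = \<phi> k z" if "z \<in> face_simplex A" for z
    using glue_face [of i k x z] assms sub that \<open>x = y\<close> by simp
  then show "cell i A = cell k B"
    unfolding cell_def AB by (intro image_cong) auto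
qed

text \<open>
  An interior point of the smaller cell lies in the interior of some face of the larger one, so the
  two are the same cell.
\<close>

lemma subcell:
  assumes "i \<in> I" "J \<in> faces {..n}" "k \<in> I" "B \<in> faces {..n}" "cell k B \<subseteq> cell i J"
  shows "B \<subseteq> J" "cell k B = cell i B"
proof -
  obtain y where y: "y \<in> face_simplex B" "support y = B"
    using ex_support_eq [of B] facesD [OF assms(4)] by auto
  then have "\<phi> k y \<in> cell i J"
    using assms(5) by (auto simp: cell_def)
  then obtain x where x: "x \<in> face_simplex J" "\<phi> k y = \<phi> i x" "support x \<in> faces J"
      "x \<in> face_simplex (support x)"
    using point_in_open_cell [OF assms(1,2)] by metis
  have "B = support x" "cell k B = cell i (support x)"
    using cells_eq_if_interiors_meet [OF assms(3,4,1) faces_mono [OF x(3) assms(2)] y x(4) refl x(2)]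
    by auto
  then show "B \<subseteq> J" "cell k B = cell i B"
    using x(3) by (auto simp: faces_def)
qed

lemma cell_in_cells [intro]: "i \<in> I \<Longrightarrow> J \<in> faces {..n} \<Longrightarrow> cell i J \<in> cells"
  by (auto simp: cells_def)

lemma cellsE:
  assumes "C \<in> cells"
  obtains i J where "i \<in> I" "J \<in> faces {..n}" "C = cell i J"
  using assms by (auto simp: cells_def)

lemma subcells:
  assumes "i \<in> I" "J \<in> faces {..n}"
  shows "{B \<in> cells. B \<subseteq> cell i J} = cell i ` faces J"
proof (intro equalityI subsetI)
  fix B assume "B \<in> {B \<in> cells. B \<subseteq> cell i J}"
  then obtain k A where *: "k \<in> I" "A \<in> faces {..n}" "B = cell k A" "cell k A \<subseteq> cell i J"
    by (auto elim: cellsE)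
  then have "A \<subseteq> J" "B = cell i A"
    using subcell [OF assms *(1,2,4)] by auto
  then show "B \<in> cell i ` faces J"
    using *(2) by (auto simp: faces_def)
next
  fix B assume "B \<in> cell i ` faces J"
  then obtain A where A: "A \<in> faces J" "B = cell i A"
    by blast
  then have An: "A \<in> faces {..n}"
    using faces_mono assms by blast
  have "cell i A \<subseteq> cell i J"
    using A(1) cell_subset_iff [OF assms(1) An assms(2)] by (simp add: faces_def)
  then show "B \<in> {B \<in> cells. B \<subseteq> cell i J}"
    using A(2) An assms(1) by auto
qed

lemma finite_faces: "finite (faces {..n})"
  by (rule finite_subset [of _ "Pow {..n}"]) (auto simp: faces_def)

lemma simplicial_cell_complex_cells: "simplicial_cell_complex cells"
  unfolding simplicial_cell_complex_def
proof (intro conjI ballI allI impI)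
  have "cells = (\<lambda>(i, J). cell i J) ` (I \<times> faces {..n})"
    by (auto simp: cells_def)
  then show "finite cells"
    by (simp add: finite_I finite_faces)
  show "\<exists>h. pl_ball h A" if "A \<in> cells" for A
    using that pl_ball_cell by (metis cellsE)
  show "\<Union>cells = (\<Union>A\<in>cells. ball_interior A)"
  proof (intro equalityI subsetI)
    fix p assume "p \<in> \<Union>cells"
    then obtain i J where iJ: "i \<in> I" "J \<in> faces {..n}" "p \<in> cell i J"
      by (auto elim: cellsE)
    then obtain x where "support x \<in> faces J" "p \<in> ball_interior (cell i (support x))"
      using point_in_open_cell by metis
    moreover have "cell i (support x) \<in> cells"
      using iJ calculation faces_mono by blast
    ultimately show "p \<in> (\<Union>A\<in>cells. ball_interior A)"
      by blast
  next
    fix p assume "p \<in> (\<Union>A\<in>cells. ball_interior A)"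
    then obtain i J where iJ: "i \<in> I" "J \<in> faces {..n}" "p \<in> ball_interior (cell i J)"
      by (auto elim: cellsE)
    then have "p \<in> cell i J"
      using ball_interior_cell by (auto simp: cell_def)
    then show "p \<in> \<Union>cells"
      using iJ by blast
  qed
  show "ball_interior A \<inter> ball_interior B = {}"
    if AB: "A \<in> cells" "B \<in> cells" "A \<noteq> B" for A B
  proof (rule ccontr)
    assume "ball_interior A \<inter> ball_interior B \<noteq> {}"
    then obtain p where p: "p \<in> ball_interior A" "p \<in> ball_interior B"
      by blast
    obtain i J where iJ: "i \<in> I" "J \<in> faces {..n}" "A = cell i J"
      using AB(1) by (rule cellsE)
    obtain k L where kL: "k \<in> I" "L \<in> faces {..n}" "B = cell k L"
      using AB(2) by (rule cellsE)
    obtain x where x: "x \<in> face_simplex J" "support x = J" "p = \<phi> i x"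
      using p(1) iJ ball_interior_cell by auto
    obtain y where y: "y \<in> face_simplex L" "support y = L" "p = \<phi> k y"
      using p(2) kL ball_interior_cell by auto
    show False
      using cells_eq_if_interiors_meet(2) [OF iJ(1,2) kL(1,2) x(1,2) y(1,2)] x(3) y(3) iJ(3) kL(3) AB(3)
      by simp
  qed
  show "\<exists>S\<subseteq>cells. A \<inter> B = \<Union>S" if AB: "A \<in> cells" "B \<in> cells" for A B
  proof (intro exI conjI)
    show "{C \<in> cells. C \<subseteq> A \<inter> B} \<subseteq> cells"
      by blast
    obtain i J where iJ: "i \<in> I" "J \<in> faces {..n}" "A = cell i J"
      using AB(1) by (rule cellsE)
    obtain k L where kL: "k \<in> I" "L \<in> faces {..n}" "B = cell k L"
      using AB(2) by (rule cellsE)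
    show "A \<inter> B = \<Union>{C \<in> cells. C \<subseteq> A \<inter> B}"
    proof (intro equalityI subsetI)
      fix p assume p: "p \<in> A \<inter> B"
      obtain x where x: "p = \<phi> i x" "support x \<in> faces J" "x \<in> face_simplex (support x)"
        using point_in_open_cell [OF iJ(1,2)] p iJ(3) by auto
      obtain y where y: "p = \<phi> k y" "support y \<in> faces L" "y \<in> face_simplex (support y)"
        using point_in_open_cell [OF kL(1,2)] p kL(3) by auto
      have X: "support x \<in> faces {..n}" and Y: "support y \<in> faces {..n}"
        using x(2) y(2) iJ(2) kL(2) faces_mono by blast+
      have eq: "cell i (support x) = cell k (support y)"
        using cells_eq_if_interiors_meet(2) [OF iJ(1) X kL(1) Y x(3) refl y(3) refl] x(1) y(1) by simp
      have "cell i (support x) \<subseteq> A"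
        using x(2) cell_subset_iff [OF iJ(1) X iJ(2)] iJ(3) by (simp add: faces_def)
      moreover have "cell i (support x) \<subseteq> B"
        using y(2) cell_subset_iff [OF kL(1) Y kL(2)] kL(3) eq by (simp add: faces_def)
      moreover have "p \<in> cell i (support x)"
        using x by (auto simp: cell_def)
      ultimately show "p \<in> \<Union>{C \<in> cells. C \<subseteq> A \<inter> B}"
        using iJ(1) X by blast
    qed blast
  qed
  show "order_isomorphic {B \<in> cells. B \<subseteq> A} (face_poset h)"
    if A: "A \<in> cells" "pl_ball h A" for A h
  proof -
    obtain i J where iJ: "i \<in> I" "J \<in> faces {..n}" "A = cell i J"
      using A(1) by (rule cellsE)
    have "h = card J - 1"
      using A(2) iJ pl_ball_cell_iff by simp
    moreover have "order_isomorphic (cell i ` faces J) (face_poset (card J - 1))"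
      unfolding cell_def faces_def
      by (rule simplex_chart.order_isomorphic_cell) (use iJ simplex_chart facesD in auto)
    ultimately show ?thesis
      using subcells iJ by simp
  qed
qed

abbreviation facet :: "'i \<Rightarrow> pt set" where
  "facet i \<equiv> cell i {..n}"

lemma top_face [simp]: "{..n} \<in> faces {..n}"
  by (auto simp: faces_def)

lemma facet_subset_imp:
  assumes "i \<in> I" "k \<in> I" "J \<in> faces {..n}" "facet i \<subseteq> cell k J"
  shows "i = k" "J = {..n}"
proof -
  have *: "{..n} \<subseteq> J" "facet i = facet k"
    using subcell [OF assms(2,3,1) top_face assms(4)] by auto
  then show "J = {..n}"
    using assms(3) by (auto simp: faces_def)
  obtain x where x: "x \<in> face_simplex {..n}" "support x = {..n}"
    using ex_support_eq [of "{..n}"] by auto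
  then have "\<phi> i x \<in> facet k"
    using *(2) by (auto simp: cell_def)
  then obtain y where y: "y \<in> face_simplex {..n}" "\<phi> i x = \<phi> k y"
    by (auto simp: cell_def)
  then have "x = y"
    using glue_point [OF assms(1,2)] x(1) by (simp add: standard_simplex_eq)
  then show "i = k"
    using glue_interior [OF assms(1,2)] x y by (simp add: standard_simplex_eq)
qed

lemma facets_cells: "facets cells = facet ` I"
proof (intro equalityI subsetI)
  fix A assume A: "A \<in> facets cells"
  then obtain i J where iJ: "i \<in> I" "J \<in> faces {..n}" "A = cell i J"
    by (auto simp: facets_def elim: cellsE)
  then have "A \<subseteq> facet i"
    using cell_subset_iff [OF iJ(1,2) top_face] by (simp add: faces_def)
  moreover have "facet i \<in> cells"
    using iJ(1) by (intro cell_in_cells) auto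
  ultimately have "A = facet i"
    using A unfolding facets_def by blast
  then show "A \<in> facet ` I"
    using iJ(1) by blast
next
  fix A assume "A \<in> facet ` I"
  then obtain i where i: "i \<in> I" "A = facet i"
    by blast
  have "A = B" if "B \<in> cells" "A \<subseteq> B" for B
    using that i facet_subset_imp by (metis cellsE)
  then show "A \<in> facets cells"
    using i by (auto simp: facets_def)
qed

lemma inj_on_facet: "inj_on facet I"
  by (rule inj_onI) (rule facet_subset_imp(1) [OF _ _ top_face], simp_all)

lemma pure_dim_cells: "pure_dim n cells"
  using pl_ball_cell [OF _ top_face] by (auto simp: pure_dim_def facets_cells)

lemma vertices_below:
  assumes "i \<in> I" "J \<in> faces {..n}"
  shows "{v \<in> vertices cells. v \<subseteq> cell i J} = (\<lambda>a. cell i {a}) ` J"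
proof (intro equalityI subsetI)
  fix v assume v: "v \<in> {v \<in> vertices cells. v \<subseteq> cell i J}"
  then have "v \<in> cell i ` faces J"
    using subcells [OF assms] by (auto simp: vertices_def)
  then obtain A where A: "A \<in> faces J" "v = cell i A"
    by blast
  then have An: "A \<in> faces {..n}"
    using faces_mono assms(2) by blast
  have "pl_ball 0 v"
    using v by (simp add: vertices_def)
  then have "0 = card A - 1"
    using A pl_ball_cell_iff [OF assms(1) An] by simp
  moreover have "card A \<noteq> 0"
    using facesD [OF An] by simp
  ultimately have "card A = 1"
    by simp
  then obtain a where "A = {a}"
    by (rule card_1_singletonE)
  then show "v \<in> (\<lambda>a. cell i {a}) ` J"
    using A by (auto simp: faces_def)
next
  fix v assume "v \<in> (\<lambda>a. cell i {a}) ` J"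
  then obtain a where a: "a \<in> J" "v = cell i {a}"
    by blast
  then have aJ: "{a} \<in> faces J"
    by (auto simp: faces_def)
  then have "v \<in> cells" "v \<subseteq> cell i J"
    using subcells [OF assms] a(2) by blast+
  moreover have "pl_ball 0 v"
    using a(2) pl_ball_cell [OF assms(1) faces_mono [OF aJ assms(2)]] by simp
  ultimately show "v \<in> {v \<in> vertices cells. v \<subseteq> cell i J}"
    by (simp add: vertices_def)
qed

lemma color_cell [simp]:
  assumes "i \<in> I" "a \<le> n"
  shows "color (cell i {a}) = a"
  unfolding color_def
proof (rule the_equality)
  show "a \<le> n \<and> (\<exists>k\<in>I. cell i {a} = cell k {a})"
    using assms by blast
  fix b assume "b \<le> n \<and> (\<exists>k\<in>I. cell i {a} = cell k {b})"
  then obtain k where "b \<le> n" "k \<in> I" "cell i {a} = cell k {b}"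
    by blast
  then show "b = a"
    using subcell(1) [of i "{a}" k "{b}"] assms by (auto simp: faces_def)
qed

lemma proper_coloring_cells: "proper_coloring n cells color"
proof -
  have below: "\<exists>i J a. i \<in> I \<and> J \<in> faces {..n} \<and> a \<in> J \<and> a \<le> n \<and> v = cell i {a}"
    if "v \<in> vertices cells" for v
  proof -
    obtain i J where iJ: "i \<in> I" "J \<in> faces {..n}" "v = cell i J"
      using \<open>v \<in> vertices cells\<close> by (auto simp: vertices_def elim: cellsE)
    then have "v \<in> (\<lambda>a. cell i {a}) ` J"
      using vertices_below [OF iJ(1,2)] that by blast
    then show ?thesis
      using iJ facesD by blast
  qed
  have "color v \<le> n" if "v \<in> vertices cells" for v
    using below [OF that] by auto
  moreover have "color v \<noteq> color w"
    if e: "e \<in> cells" "v \<in> vertices cells" "w \<in> vertices cells" "v \<subseteq> e" "w \<subseteq> e" "v \<noteq> w" for e v w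
  proof -
    obtain i J where iJ: "i \<in> I" "J \<in> faces {..n}" "e = cell i J"
      using e(1) by (rule cellsE)
    have "v \<in> (\<lambda>a. cell i {a}) ` J" "w \<in> (\<lambda>a. cell i {a}) ` J"
      using vertices_below [OF iJ(1,2)] e iJ(3) by blast+
    then obtain a b where ab: "a \<in> J" "v = cell i {a}" "b \<in> J" "w = cell i {b}"
      by blast
    then have "color v = a" "color w = b"
      using iJ(1) facesD [OF iJ(2)] by auto
    then show ?thesis
      using e(6) ab by auto
  qed
  ultimately show ?thesis
    unfolding proper_coloring_def by blast
qed

lemma Union_cells: "\<Union>cells = (\<Union>i\<in>I. \<phi> i ` standard_simplex n)"
proof (intro equalityI subsetI)
  fix p assume "p \<in> \<Union>cells"
  then obtain i J where iJ: "i \<in> I" "J \<in> faces {..n}" "p \<in> cell i J"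
    by (auto elim: cellsE)
  then have "p \<in> \<phi> i ` standard_simplex n"
    using face_subset_simplex [OF iJ(2)] by (auto simp: cell_def)
  then show "p \<in> (\<Union>i\<in>I. \<phi> i ` standard_simplex n)"
    using iJ(1) by blast
next
  fix p assume "p \<in> (\<Union>i\<in>I. \<phi> i ` standard_simplex n)"
  then obtain i where "i \<in> I" "p \<in> facet i"
    by (auto simp: cell_def standard_simplex_eq)
  then show "p \<in> \<Union>cells"
    using cell_in_cells [OF _ top_face] by blast
qed

end


section \<open>The two-facet sphere and folding maps onto it\<close>

lemma std_complex_eq:
  "std_complex n = insert (std_cone n) (face_simplex ` {A. A \<noteq> {} \<and> A \<subseteq> {..n}})"
  by (simp add: std_complex_def face_poset_eq)

lemma std_cone_eq: "std_cone n = {x \<in> face_simplex {..Suc n}. \<exists>i\<le>n. x i = 0}"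
  by (simp add: std_cone_def standard_simplex_eq)

text \<open>
  The cone contains exactly the proper faces of the standard simplex.
\<close>

lemma face_subset_std_cone_iff:
  assumes "A \<subseteq> {..n}"
  shows "face_simplex A \<subseteq> std_cone n \<longleftrightarrow> A \<noteq> {..n}"
proof
  assume sub: "face_simplex A \<subseteq> std_cone n"
  show "A \<noteq> {..n}"
  proof
    assume "A = {..n}"
    then obtain x where "x \<in> face_simplex A" "support x = {..n}"
      using ex_support_eq [of "{..n}"] by auto
    then show False
      using sub by (auto simp: std_cone_eq support_def)
  qed
next
  assume "A \<noteq> {..n}"
  then obtain i where i: "i \<le> n" "i \<notin> A"
    using assms by auto
  have "A \<subseteq> {..Suc n}"
    using assms by auto
  then have "face_simplex A \<subseteq> face_simplex {..Suc n}"
    by (intro face_simplex_mono) auto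
  then show "face_simplex A \<subseteq> std_cone n"
    using i by (auto simp: std_cone_eq face_simplex_def)
qed

lemma std_cone_not_subset_simplex:
  assumes "A \<subseteq> {..n}"
  shows "\<not> std_cone n \<subseteq> face_simplex A"
proof
  assume "std_cone n \<subseteq> face_simplex A"
  moreover have "corner (Suc n) \<in> std_cone n"
    by (auto simp: std_cone_eq) (auto simp: corner_def)
  ultimately have "Suc n \<in> A"
    using corner_in_face_simplex [of A "Suc n"] finite_subset [OF assms] by blast
  then show False
    using assms by auto
qed

lemma subcells_std_simplex:
  assumes "J \<subseteq> {..n}"
  shows "{C \<in> std_complex n. C \<subseteq> face_simplex J} = face_simplex ` {A. A \<noteq> {} \<and> A \<subseteq> J}"
proof -
  have "face_simplex A \<subseteq> face_simplex J \<longleftrightarrow> A \<subseteq> J" if "A \<subseteq> {..n}" for A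
    using that assms finite_subset [of _ "{..n}"] by (intro face_simplex_subset_iff) auto
  then have faces: "{A. A \<noteq> {} \<and> A \<subseteq> J} =
      {A. (A \<noteq> {} \<and> A \<subseteq> {..n}) \<and> face_simplex A \<subseteq> face_simplex J}"
    using assms by auto
  have "{C \<in> face_simplex ` {A. A \<noteq> {} \<and> A \<subseteq> {..n}}. C \<subseteq> face_simplex J}
      = face_simplex ` {A. A \<noteq> {} \<and> A \<subseteq> J}"
    unfolding faces by auto
  then show ?thesis
    using std_cone_not_subset_simplex [OF assms] unfolding std_complex_eq by blast
qed

lemma subcells_std_cone:
  "{C \<in> std_complex n. C \<subseteq> std_cone n} =
    insert (std_cone n) (face_simplex ` {A. A \<noteq> {} \<and> A \<subset> {..n}})"
  using face_subset_std_cone_iff [of _ n] unfolding std_complex_eq by auto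

lemma facets_std_complex: "facets (std_complex n) = {standard_simplex n, std_cone n}"
proof (intro equalityI subsetI)
  fix C assume C: "C \<in> facets (std_complex n)"
  have simplex: "standard_simplex n \<in> std_complex n"
    unfolding std_complex_eq standard_simplex_eq by auto
  show "C \<in> {standard_simplex n, std_cone n}"
  proof (cases "C = std_cone n")
    case False
    then obtain A where "A \<subseteq> {..n}" "C = face_simplex A"
      using C by (auto simp: facets_def std_complex_eq)
    then have "C \<subseteq> standard_simplex n"
      unfolding standard_simplex_eq by (simp add: face_simplex_mono)
    then show ?thesis
      using C simplex by (simp add: facets_def)
  qed simp
next
  fix C assume C: "C \<in> {standard_simplex n, std_cone n}"
  have "C \<in> std_complex n"
    using C unfolding std_complex_eq standard_simplex_eq by auto
  moreover have "C = B" if B: "B \<in> std_complex n" "C \<subseteq> B" for B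
  proof (cases "B = std_cone n")
    case True
    then show ?thesis
      using C B face_subset_std_cone_iff [of "{..n}" n] by (auto simp: standard_simplex_eq)
  next
    case False
    then obtain A where A: "A \<subseteq> {..n}" "B = face_simplex A"
      using B by (auto simp: std_complex_eq)
    then have "C = standard_simplex n"
      using B C std_cone_not_subset_simplex by auto
    moreover have "face_simplex {..n} \<subseteq> face_simplex A \<longleftrightarrow> {..n} \<subseteq> A"
      using A(1) finite_subset by (intro face_simplex_subset_iff) auto
    ultimately show ?thesis
      using A B by (auto simp: standard_simplex_eq)
  qed
  ultimately show "C \<in> facets (std_complex n)"
    by (simp add: facets_def)
qed

lemma std_simplex_neq_cone: "standard_simplex n \<noteq> std_cone n"
  using std_cone_not_subset_simplex [of "{..n}" n] by (auto simp: standard_simplex_eq)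

lemma std_color_corner [simp]: "std_color {corner i} = i"
  unfolding std_color_def corner_def [symmetric]
proof (rule the_equality)
  fix k assume "{corner i} = {corner k}"
  then have "support (corner i) = support (corner k)"
    by simp
  then show "k = i"
    by simp
qed simp

lemma pl_ball_standard_simplex: "pl_ball n (standard_simplex n)"
proof -
  have "pl_map (standard_simplex n) (\<lambda>x. x)"
    unfolding pl_map_alt standard_simplex_eq
    by (intro conjI continuous_on_id exI [of _ "{face_simplex {..n}}"])
      (auto simp: affine_on_def)
  then have "pl_homeomorphism (standard_simplex n) ((\<lambda>x. x) ` standard_simplex n) (\<lambda>x. x)"
    by (rule pl_homeomorphism_onto_image) (simp_all add: standard_simplex_eq compact_face_simplex)
  then show ?thesis
    by (auto simp: pl_ball_def pl_homeomorphic_def)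
qed

text \<open>
  The simplex is pushed towards the apex: its least coordinate is subtracted from all coordinates of a
  point, and the total loss becomes the coordinate \<open>n+1\<close>. This fixes the boundary.
\<close>

lemma pl_ball_std_cone: "pl_ball n (std_cone n)"
proof -
  define q :: pt where "q = (\<lambda>i. if i \<le> n then - 1 else if i = Suc n then real (Suc n) else 0)"
  define f :: "pt \<Rightarrow> pt" where "f x = x + Min (x ` {..n}) *\<^sub>R q" for x
  let ?\<Delta> = "face_simplex {..n}"
  have "pl_map ?\<Delta> f"
    unfolding f_def by (rule pl_map_add_Min) (auto simp: linear_id [unfolded id_def])
  have top: "f x (Suc n) = real (Suc n) * Min (x ` {..n})" if "x \<in> ?\<Delta>" for x :: pt
    using that by (simp add: f_def q_def face_simplex_def)
  have inj: "inj_on f ?\<Delta>"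
  proof (rule inj_onI)
    fix x y assume *: "x \<in> ?\<Delta>" "y \<in> ?\<Delta>" "f x = f y"
    then have "real (Suc n) * Min (x ` {..n}) = real (Suc n) * Min (y ` {..n})"
      using top by metis
    then have "Min (x ` {..n}) = Min (y ` {..n})"
      by (simp del: of_nat_Suc)
    then show "x = y"
      using *(3) by (simp add: f_def)
  qed
  have "f ` ?\<Delta> = std_cone n"
  proof (intro equalityI subsetI)
    fix z assume "z \<in> f ` ?\<Delta>"
    then obtain x where x: "x \<in> ?\<Delta>" "z = f x"
      by blast
    define m where "m = Min (x ` {..n})"
    have "m \<in> x ` {..n}"
      unfolding m_def by (rule Min_in) auto
    then obtain i where i: "i \<le> n" "x i = m"
      by auto
    have m: "m \<le> x k" if "k \<le> n" for k
      using that by (simp add: m_def)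
    have z: "z k = (if k \<le> n then x k - m else if k = Suc n then Suc n * m else 0)" for k
      using x by (simp add: f_def q_def m_def face_simplex_def)
    have "0 \<le> m"
      using i x(1) by (auto simp: face_simplex_def)
    moreover have "sum z {..Suc n} = 1"
    proof -
      have "(\<Sum>k\<le>n. z k) = (\<Sum>k\<le>n. x k) - Suc n * m"
        by (simp add: z sum_subtractf)
      then show ?thesis
        using x(1) by (simp add: z face_simplex_def)
    qed
    ultimately show "z \<in> std_cone n"
      using i m by (auto simp: std_cone_eq face_simplex_def z)
  next
    fix z assume "z \<in> std_cone n"
    then obtain i where z: "z \<in> face_simplex {..Suc n}" and i: "i \<le> n" "z i = 0"
      by (auto simp: std_cone_eq)
    \<comment> \<open>The height over the base, spread evenly over the coordinates up to \<open>n\<close>, undoes the push.\<close>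
    define m where "m = z (Suc n) / Suc n"
    define x :: pt where "x = (\<lambda>k. if k \<le> n then z k + m else 0)"
    have m0: "0 \<le> m"
      using z by (simp add: m_def face_simplex_def)
    have "sum x {..n} = 1"
    proof -
      have "sum x {..n} = sum z {..n} + Suc n * m"
        by (simp add: x_def sum.distrib)
      also have "Suc n * m = z (Suc n)"
        unfolding m_def by (simp del: of_nat_Suc)
      finally show ?thesis
        using z by (simp add: face_simplex_def)
    qed
    then have x: "x \<in> ?\<Delta>"
      using z m0 by (auto simp: x_def face_simplex_def)
    have "Min (x ` {..n}) = m"
      using i z by (intro Min_eqI) (auto simp: x_def face_simplex_def intro: image_eqI [of _ _ i])
    moreover have "z k = x k + m * q k" for k
    proof (cases "k \<le> Suc n")
      case True
      then show ?thesis
        by (auto simp: x_def q_def m_def le_Suc_eq simp del: of_nat_Suc)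
    next
      case False
      then show ?thesis
        using z by (simp add: x_def q_def face_simplex_def)
    qed
    ultimately have "z = f x"
      by (simp add: f_def fun_eq_iff)
    then show "z \<in> f ` ?\<Delta>"
      using x by blast
  qed
  moreover have "pl_homeomorphism ?\<Delta> (f ` ?\<Delta>) f"
    using \<open>pl_map ?\<Delta> f\<close> inj by (rule pl_homeomorphism_onto_image) (simp add: compact_face_simplex)
  ultimately show ?thesis
    by (auto simp: pl_ball_def pl_homeomorphic_def standard_simplex_eq)
qed

lemma frag_cmul_diff_distrib_right: "frag_cmul c (a - b) = frag_cmul c a - frag_cmul c b"
  by (rule poly_mapping_eqI) (simp add: lookup_minus right_diff_distrib)

lemma sum_frag_of_const: "finite Y \<Longrightarrow> (\<Sum>i\<in>Y. frag_of c) = frag_cmul (card Y) (frag_of c)"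
  by (induction Y rule: finite_induct) (auto simp: frag_cmul_distrib)

lemma sum_if_mem:
  assumes "finite X"
  shows "(\<Sum>i\<in>X. frag_of (if i \<in> S then a else b))
    = frag_cmul (card (X \<inter> S)) (frag_of a) + frag_cmul (card (X - S)) (frag_of b)"
proof -
  have "(\<Sum>i\<in>X. frag_of (if i \<in> S then a else b))
      = (\<Sum>i\<in>X \<inter> S. frag_of (if i \<in> S then a else b)) + (\<Sum>i\<in>X - S. frag_of (if i \<in> S then a else b))"
    using assms by (subst sum.union_disjoint [symmetric]) (auto simp: Int_Diff_Un)
  also have "\<dots> = (\<Sum>i\<in>X \<inter> S. frag_of a) + (\<Sum>i\<in>X - S. frag_of b)"
    by (intro arg_cong2 [of _ _ _ _ "(+)"] sum.cong) auto
  finally show ?thesis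
    using assms by (simp add: sum_frag_of_const)
qed

context glued_charts
begin

text \<open>
  The facets with index in \<open>S\<close> go to the standard simplex, the other facets to the cone, and every
  smaller cell to the face with the same colors.
\<close>

definition fold_map :: "'i set \<Rightarrow> pt set \<Rightarrow> pt set" where
  "fold_map S C = (if C \<in> facet ` (I - S) then std_cone n
     else face_simplex (color ` {v \<in> vertices cells. v \<subseteq> C}))"

lemma fold_map_cell:
  assumes "i \<in> I" "J \<in> faces {..n}"
  shows "fold_map S (cell i J) = (if J = {..n} \<and> i \<notin> S then std_cone n else face_simplex J)"
proof -
  have "cell i J \<in> facet ` (I - S) \<longleftrightarrow> J = {..n} \<and> i \<notin> S"
  proof
    assume "cell i J \<in> facet ` (I - S)"
    then obtain k where k: "k \<in> I" "k \<notin> S" "cell i J = facet k"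
      by blast
    then show "J = {..n} \<and> i \<notin> S"
      using facet_subset_imp [OF k(1) assms] by simp
  qed (use assms in blast)
  moreover have "color ` {v \<in> vertices cells. v \<subseteq> cell i J} = J"
  proof -
    have "(\<lambda>a. color (cell i {a})) ` J = (\<lambda>a. a) ` J"
      using assms(1) facesD [OF assms(2)] by (intro image_cong) auto
    then show ?thesis
      unfolding vertices_below [OF assms] image_image by simp
  qed
  ultimately show ?thesis
    by (simp add: fold_map_def)
qed

lemma simplicial_map_fold_map: "simplicial_map cells (std_complex n) (fold_map S)"
  unfolding simplicial_map_def
proof (intro ballI conjI)
  fix C assume "C \<in> cells"
  then obtain i J where iJ: "i \<in> I" "J \<in> faces {..n}" "C = cell i J"
    by (rule cellsE)
  show "fold_map S C \<in> std_complex n"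
    using iJ facesD [OF iJ(2)] by (auto simp: fold_map_cell std_complex_eq)
  have img: "fold_map S ` {B \<in> cells. B \<subseteq> C}
      = (\<lambda>A. if A = {..n} \<and> i \<notin> S then std_cone n else face_simplex A) ` faces J"
    unfolding iJ(3) subcells [OF iJ(1,2)] image_image
    using iJ(1) faces_mono [OF _ iJ(2)] by (intro image_cong) (auto simp: fold_map_cell)
  show "fold_map S ` {B \<in> cells. B \<subseteq> C} = {D \<in> std_complex n. D \<subseteq> fold_map S C}"
  proof (cases "J = {..n} \<and> i \<notin> S")
    case True
    then have split: "faces J = insert {..n} {A. A \<noteq> {} \<and> A \<subset> {..n}}"
      by (auto simp: faces_def)
    have "(\<lambda>A. if A = {..n} \<and> i \<notin> S then std_cone n else face_simplex A) ` {A. A \<noteq> {} \<and> A \<subset> {..n}}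
        = face_simplex ` {A. A \<noteq> {} \<and> A \<subset> {..n}}"
      by (intro image_cong) auto
    then have "(\<lambda>A. if A = {..n} \<and> i \<notin> S then std_cone n else face_simplex A) ` faces J
        = insert (std_cone n) (face_simplex ` {A. A \<noteq> {} \<and> A \<subset> {..n}})"
      using True unfolding split image_insert by simp
    then show ?thesis
      using True iJ(1) img unfolding iJ(3) by (simp add: fold_map_cell subcells_std_cone)
  next
    case False
    have "(\<lambda>A. if A = {..n} \<and> i \<notin> S then std_cone n else face_simplex A) ` faces J
        = face_simplex ` {A. A \<noteq> {} \<and> A \<subseteq> J}"
      unfolding faces_def using False facesD [OF iJ(2)] by (intro image_cong) auto
    then show ?thesis
      using False iJ(1,2) img facesD [OF iJ(2)] unfolding iJ(3)
      by (simp only: fold_map_cell subcells_std_simplex if_False)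
  qed
qed

lemma vertex_of_color_facet:
  assumes "i \<in> I" "a \<le> n"
  shows "vertex_of_color cells color (facet i) a = cell i {a}"
  unfolding vertex_of_color_def
proof (rule the_equality)
  have below: "v \<in> vertices cells \<and> v \<subseteq> facet i \<longleftrightarrow> v \<in> (\<lambda>a. cell i {a}) ` {..n}" for v
    using vertices_below [OF assms(1) top_face] by blast
  then have "cell i {a} \<in> vertices cells \<and> cell i {a} \<subseteq> facet i"
    using assms(2) by blast
  then show "cell i {a} \<in> vertices cells \<and> cell i {a} \<subseteq> facet i \<and> color (cell i {a}) = a"
    using assms by simp
  fix v assume v: "v \<in> vertices cells \<and> v \<subseteq> facet i \<and> color v = a"
  then obtain b where "b \<le> n" "v = cell i {b}"
    using below by blast
  then show "v = cell i {a}"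
    using v assms(1) by simp
qed

lemma color_permutation_facet:
  assumes "i \<in> I" "n \<ge> 1"
  shows "color_permutation n cells color std_color (fold_map S) (facet i) = id"
proof
  fix a
  have "std_color (fold_map S (cell i {a})) = a" if "a \<le> n"
  proof -
    have "{a} \<noteq> {..n}"
      using assms(2) by (metis atMost_iff le0 singletonD not_one_le_zero order_refl)
    moreover have "{a} \<in> faces {..n}"
      using that by (simp add: faces_def)
    ultimately show ?thesis
      using assms(1) by (simp add: fold_map_cell)
  qed
  then show "color_permutation n cells color std_color (fold_map S) (facet i) a = id a"
    using assms(1) by (simp add: color_permutation_def vertex_of_color_facet)
qed

text \<open>
  The map preserves colors, so no signs from permutations occur. The coefficient of the standard simplex
  is the number of positive minus the number of negative facets in \<open>S\<close>. As there are as many positive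
  as negative facets in total, the coefficient of the cone is the opposite number.
\<close>

lemma has_degree_fold_map:
  assumes "n \<ge> 1" and T: "T \<subseteq> I" "card T = card (I - T)" and S: "S \<subseteq> I"
  shows "has_degree n cells color (facet ` T) (std_complex n) std_color (std_positive n)
    (fold_map S) (int (card (T \<inter> S)) - int (card (S - T)))"
proof -
  let ?push = "push_chain n cells color std_color (fold_map S)"
  let ?\<Delta> = "frag_of (standard_simplex n)" and ?C = "frag_of (std_cone n)"
  let ?p = "int (card (T \<inter> S))" and ?q = "int (card ((I - T) \<inter> S))"
  have finT: "finite T" "finite (I - T)"
    using T(1) finite_I finite_subset by auto
  have facet: "?push (frag_of (facet i)) = frag_of (if i \<in> S then standard_simplex n else std_cone n)"
    if "i \<in> I" for i
  proof -
    have "fold_map S (facet i) = (if i \<in> S then standard_simplex n else std_cone n)"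
      using that by (simp add: fold_map_cell standard_simplex_eq)
    then show ?thesis
      using that assms(1) color_permutation_facet
      by (simp add: push_chain_def pl_ball_standard_simplex pl_ball_std_cone sign_id)
  qed
  have sums: "?push (\<Sum>A\<in>facet ` X. frag_of A)
      = frag_cmul (card (X \<inter> S)) ?\<Delta> + frag_cmul (card (X - S)) ?C"
    if X: "X \<subseteq> I" for X
  proof -
    have fin: "finite X"
      using X finite_I finite_subset by blast
    have "(\<Sum>A\<in>facet ` X. frag_of A) = (\<Sum>i\<in>X. frag_of (facet i))"
      using inj_on_subset [OF inj_on_facet X] by (simp add: sum.reindex)
    then have "?push (\<Sum>A\<in>facet ` X. frag_of A) = (\<Sum>i\<in>X. ?push (frag_of (facet i)))"
      using fin by (simp add: push_chain_def frag_extend_sum)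
    also have "\<dots> = (\<Sum>i\<in>X. frag_of (if i \<in> S then standard_simplex n else std_cone n))"
      using X facet by (intro sum.cong) auto
    finally show ?thesis
      using sum_if_mem [OF fin] by simp
  qed
  have "facets cells \<inter> facet ` T = facet ` T" "facets cells - facet ` T = facet ` (I - T)"
    using T(1) inj_on_facet by (auto simp: facets_cells inj_on_def)
  then have "?push (fundamental_cycle cells (facet ` T))
      = ?push (\<Sum>A\<in>facet ` T. frag_of A) - ?push (\<Sum>A\<in>facet ` (I - T). frag_of A)"
    by (simp add: fundamental_cycle_def push_chain_def frag_extend_diff)
  also have "\<dots> = frag_cmul ?p ?\<Delta> + frag_cmul (card (T - S)) ?C
      - (frag_cmul ?q ?\<Delta> + frag_cmul (card (I - T - S)) ?C)"
    using sums [OF T(1)] sums [of "I - T"] by simp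
  also have "\<dots> = frag_cmul (?p - ?q) (?\<Delta> - ?C)"
  proof -
    have "int (card (T - S)) - int (card (I - T - S)) = - (?p - ?q)"
      using T(2) card_Int_Diff [OF finT(1), of S] card_Int_Diff [OF finT(2), of S] by simp
    then have C: "frag_cmul (card (T - S)) ?C - frag_cmul (card (I - T - S)) ?C = - frag_cmul (?p - ?q) ?C"
      by (metis frag_cmul_diff_distrib minus_frag_cmul)
    have "frag_cmul ?p ?\<Delta> + frag_cmul (card (T - S)) ?C
        - (frag_cmul ?q ?\<Delta> + frag_cmul (card (I - T - S)) ?C)
      = (frag_cmul ?p ?\<Delta> - frag_cmul ?q ?\<Delta>) +
        (frag_cmul (card (T - S)) ?C - frag_cmul (card (I - T - S)) ?C)"
      by (simp add: algebra_simps)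
    also have "\<dots> = frag_cmul (?p - ?q) ?\<Delta> - frag_cmul (?p - ?q) ?C"
      unfolding C by (simp add: frag_cmul_diff_distrib)
    finally show ?thesis
      by (simp add: frag_cmul_diff_distrib_right)
  qed
  also have "?\<Delta> - ?C = fundamental_cycle (std_complex n) (std_positive n)"
  proof -
    have "{standard_simplex n, std_cone n} \<inter> {standard_simplex n} = {standard_simplex n}"
      "{standard_simplex n, std_cone n} - {standard_simplex n} = {std_cone n}"
      using std_simplex_neq_cone by auto
    then show ?thesis
      by (simp add: fundamental_cycle_def facets_std_complex std_positive_def)
  qed
  also have "(I - T) \<inter> S = S - T"
    using S by blast
  finally show ?thesis
    by (simp add: has_degree_def)
qed

text \<open>
  A ridge is shared with the same labels, and the two charts then agree at an interior point of it.
  So coherence needs to be tested only at points with exactly one vanishing coordinate.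
\<close>

lemma oriented_colored_triangulation_cells:
  assumes "n \<ge> 1" and T: "T \<subseteq> I" and M: "pl_homeomorphic (\<Union>cells) M"
    and ridge: "\<And>i k x. i \<in> I \<Longrightarrow> k \<in> I \<Longrightarrow> i \<noteq> k \<Longrightarrow> x \<in> standard_simplex n \<Longrightarrow>
      card (support x) = n \<Longrightarrow> \<phi> i x = \<phi> k x \<Longrightarrow> i \<in> T \<longleftrightarrow> k \<notin> T"
  shows "oriented_colored_triangulation n M cells color (facet ` T)"
  unfolding oriented_colored_triangulation_def colored_triangulation_def
proof (intro conjI ballI impI)
  show "facet ` T \<subseteq> facets cells"
    using T by (auto simp: facets_cells)
  fix A B F assume A: "A \<in> facets cells" and B: "B \<in> facets cells" and F: "F \<in> cells"
    and *: "A \<noteq> B \<and> pl_ball (n - 1) F \<and> F \<subseteq> A \<and> F \<subseteq> B"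
  obtain i k where i: "i \<in> I" "A = facet i" and k: "k \<in> I" "B = facet k"
    using A B by (auto simp: facets_cells)
  obtain j J where j: "j \<in> I" "J \<in> faces {..n}" "F = cell j J"
    using F by (rule cellsE)
  have Fi: "F = cell i J" and Fk: "F = cell k J"
    using subcell(2) [OF i(1) top_face j(1,2)] subcell(2) [OF k(1) top_face j(1,2)] * i k j(3) by auto
  obtain x where x: "x \<in> face_simplex J" "support x = J"
    using ex_support_eq [of J] facesD [OF j(2)] by auto
  then have "\<phi> i x \<in> cell k J"
    using Fi Fk by (auto simp: cell_def)
  then obtain y where y: "y \<in> face_simplex J" "\<phi> i x = \<phi> k y"
    by (auto simp: cell_def)
  have xy: "x \<in> standard_simplex n" "y \<in> standard_simplex n"
    using x(1) y(1) face_subset_simplex [OF j(2)] by auto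
  then have "\<phi> i x = \<phi> k x"
    using glue_point [OF i(1) k(1) xy y(2)] y(2) by simp
  moreover have "card (support x) = n"
  proof -
    have "card J - 1 = n - 1"
      using * pl_ball_cell_iff [OF j(1,2)] j(3) by simp
    moreover have "card J \<noteq> 0"
      using facesD [OF j(2)] by simp
    ultimately show ?thesis
      using assms(1) x(2) by simp
  qed
  moreover have "i \<noteq> k"
    using * i k by auto
  ultimately have "i \<in> T \<longleftrightarrow> k \<notin> T"
    using ridge [OF i(1) k(1)] xy by blast
  moreover have "facet l \<in> facet ` T \<longleftrightarrow> l \<in> T" if "l \<in> I" for l
    using inj_on_image_mem_iff [OF inj_on_facet that T] .
  ultimately show "A \<in> facet ` T \<longleftrightarrow> B \<notin> facet ` T"
    using i k by simp
qed (use simplicial_cell_complex_cells pure_dim_cells proper_coloring_cells M in auto)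

end


section \<open>A polygon of facets around a codimension-two sphere\<close>

text \<open>
  The polygon has vertices and edges \<open>0, ..., N+1\<close>. The vertices \<open>0, ..., N\<close> are equidistant on the
  segment from the barycenter of \<open>\<tau>\<close> to the vertex \<open>0\<close> of the sphere, and the last one is the
  vertex \<open>n+1\<close>. Since \<open>N\<close> is even, parity alternates along the whole circle. With \<open>N \<ge> 2\<close> there are
  at least four vertices, so an edge is determined by its two ends.
\<close>

locale polygon =
  fixes n N :: nat
  assumes n_pos: "n \<ge> 1" and N_pos: "N \<ge> 2" and even_N: "even N"
begin

text \<open>
  The barycentric coordinates of a vertex of the polygon in the triangle, with respect to the vertex \<open>0\<close>,
  the barycenter of \<open>\<tau>\<close>, and the vertex \<open>n+1\<close>.
\<close>

definition a :: "nat \<Rightarrow> real" where "a v = (if v \<le> N then v / N else 0)"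
definition b :: "nat \<Rightarrow> real" where "b v = (if v \<le> N then 1 - v / N else 0)"
definition c :: "nat \<Rightarrow> real" where "c v = (if v \<le> N then 0 else 1)"

definition corner_point :: "nat \<Rightarrow> pt" where
  "corner_point v = (\<lambda>i. if i = 0 then a v else if i \<le> n then b v / n else if i = Suc n then c v else 0)"

definition succ :: "nat \<Rightarrow> nat" where "succ j = (if j = Suc N then 0 else Suc j)"

definition odd_end :: "nat \<Rightarrow> nat" where "odd_end j = (if odd j then j else succ j)"
definition even_end :: "nat \<Rightarrow> nat" where "even_end j = (if even j then j else succ j)"

definition low :: "pt \<Rightarrow> real" where "low x = Min (x ` {1..n})"

definition base :: "pt \<Rightarrow> pt" where
  "base x = (\<lambda>i. if 1 \<le> i \<and> i \<le> n then x i else 0)"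

text \<open>
  A point of the standard simplex decomposes as \<open>x 0\<close> times the vertex \<open>0\<close>, plus \<open>n * low x\<close> times the
  barycenter of \<open>\<tau>\<close>, plus a remainder in the cone over the boundary of \<open>\<tau>\<close>, which has the coordinates
  \<open>x i - low x\<close>. The chart keeps the remainder and replaces the vertex \<open>0\<close> and the barycenter by the
  odd and the even end of the edge.
\<close>

definition chart :: "nat \<Rightarrow> pt \<Rightarrow> pt" where
  "chart j x = (x 0 *\<^sub>R corner_point (odd_end j) + base x)
     + low x *\<^sub>R (real n *\<^sub>R corner_point (even_end j) - base (\<lambda>_. 1))"

lemma abc_nonneg [simp]: "0 \<le> a v" "0 \<le> b v" "0 \<le> c v"
  using N_pos by (auto simp: a_def b_def c_def)

lemma abc_sum: "a v + b v + c v = 1"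
  by (auto simp: a_def b_def c_def)

lemma n_real_pos: "0 < real n"
  using n_pos by simp

lemma low_le: "i \<in> {1..n} \<Longrightarrow> low x \<le> x i"
  by (simp add: low_def)

lemma low_attained: "\<exists>i\<in>{1..n}. x i = low x"
proof -
  have "low x \<in> x ` {1..n}"
    unfolding low_def using n_pos by (intro Min_in) auto
  then show ?thesis
    by auto
qed

lemma low_nonneg:
  assumes "x \<in> standard_simplex n"
  shows "0 \<le> low x"
proof -
  obtain i where "x i = low x"
    using low_attained by blast
  moreover have "0 \<le> x i"
    using assms by (simp add: standard_simplex_def)
  ultimately show ?thesis
    by simp
qed

lemma low_eqI: "i \<in> {1..n} \<Longrightarrow> x i = m \<Longrightarrow> (\<And>k. k \<in> {1..n} \<Longrightarrow> m \<le> x k) \<Longrightarrow> low x = m"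
  using low_attained [of x] low_le [of i x] by force

lemma chart_0: "chart j x 0 = x 0 * a (odd_end j) + n * low x * a (even_end j)"
  by (simp add: chart_def corner_point_def base_def)

lemma chart_Suc_n: "chart j x (Suc n) = x 0 * c (odd_end j) + n * low x * c (even_end j)"
  by (simp add: chart_def corner_point_def base_def)

lemma chart_mid:
  assumes "i \<in> {1..n}"
  shows "chart j x i = x i - low x + (x 0 * b (odd_end j) + n * low x * b (even_end j)) / n"
  using assms n_pos by (simp add: chart_def corner_point_def base_def field_simps)

lemma chart_outside: "Suc n < i \<Longrightarrow> chart j x i = 0"
  by (simp add: chart_def corner_point_def base_def)

lemma low_chart: "low (chart j x) = (x 0 * b (odd_end j) + n * low x * b (even_end j)) / n"
proof -
  obtain i where i: "i \<in> {1..n}" "x i = low x"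
    using low_attained by blast
  show ?thesis
    by (rule low_eqI [OF i(1)]) (use i low_le in \<open>auto simp: chart_mid\<close>)
qed

text \<open>
  Piecewise linear hat functions on the cone over the circle, in the coordinates of the triangle: each is
  homogeneous, equal to \<open>1\<close> at the vertex \<open>v\<close> and zero on all edges not incident to \<open>v\<close>. They
  recover the coefficients of a point with respect to the ends of its edge without
  knowledge of the edge.
\<close>

definition hat :: "nat \<Rightarrow> real \<Rightarrow> real \<Rightarrow> real \<Rightarrow> real" where
  "hat v A B C = (if v \<le> N then max 0 (A + B - \<bar>real N * A - real v * (A + B)\<bar>) else C)"

lemma hat_edge:
  assumes "0 \<le> \<alpha>" "0 \<le> \<beta>" "j \<le> Suc N" "v \<le> Suc N"
  shows "hat v (\<alpha> * a j + \<beta> * a (succ j)) (\<alpha> * b j + \<beta> * b (succ j)) (\<alpha> * c j + \<beta> * c (succ j))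
    = (if v = j then \<alpha> else if v = succ j then \<beta> else 0)"
proof -
  have N: "0 < real N"
    using N_pos by simp
  consider "j < N" | "j = N" | "j = Suc N"
    using assms(3) by linarith
  then show ?thesis
  proof cases
    case 1
    define A B where "A = \<alpha> * a j + \<beta> * a (succ j)" and "B = \<alpha> * b j + \<beta> * b (succ j)"
    have AB: "A + B = \<alpha> + \<beta>" and NA: "N * A = \<alpha> * j + \<beta> * (j + 1)"
      using 1 N by (simp_all add: A_def B_def a_def b_def succ_def field_simps)
    show ?thesis
    proof (cases "v \<le> N")
      case True
      have eq: "N * A - v * (\<alpha> + \<beta>) = \<alpha> * (real j - v) + \<beta> * (real j + 1 - v)"
        unfolding NA by (simp add: algebra_simps)
      have "max 0 (A + B - \<bar>N * A - v * (A + B)\<bar>) = (if v = j then \<alpha> else if v = succ j then \<beta> else 0)"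
      proof -
        consider "v = j" | "v = Suc j" | "v < j" | "v > Suc j"
          by linarith
        then show ?thesis
        proof cases
          case 3
          then have "\<alpha> * 1 \<le> \<alpha> * (real j - v)" "\<beta> * 1 \<le> \<beta> * (real j + 1 - v)"
            using assms by (intro mult_left_mono; simp)+
          then show ?thesis
            unfolding AB eq using 3 1 assms by (auto simp: succ_def)
        next
          case 4
          then have "\<alpha> * 1 \<le> \<alpha> * (v - real j)" "\<beta> * 1 \<le> \<beta> * (v - real j - 1)"
            using assms by (intro mult_left_mono; simp)+
          then have "\<alpha> + \<beta> \<le> - (\<alpha> * (real j - v) + \<beta> * (real j + 1 - v))"
            by (simp add: algebra_simps)
          then show ?thesis
            unfolding AB eq using 4 1 assms by (auto simp: succ_def)
        qed (unfold AB eq, use assms 1 in \<open>auto simp: succ_def\<close>)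
      qed
      then show ?thesis
        using True by (simp add: hat_def A_def B_def)
    qed (use 1 assms in \<open>auto simp: hat_def c_def succ_def\<close>)
  next
    case 2
    have "v = N \<or> \<alpha> \<le> \<alpha> * (N - real v)" if "v \<le> N"
      using that assms(1) by (cases "v = N") (auto simp: mult_le_cancel_left1)
    then show ?thesis
      using 2 assms N by (auto simp: hat_def a_def b_def c_def succ_def algebra_simps)
  next
    case 3
    have "v = 0 \<or> \<beta> \<le> v * \<beta>"
      using assms(2) by (cases "v = 0") (auto simp: mult_le_cancel_right1)
    then show ?thesis
      using 3 assms N by (auto simp: hat_def a_def b_def c_def succ_def)
  qed
qed

definition coord :: "nat \<Rightarrow> pt \<Rightarrow> real" where
  "coord v z = hat v (z 0) (n * low z) (z (Suc n))"

text \<open>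
  The hat functions extend to the sphere because \<open>n * low z\<close> is the coefficient of the barycenter
  of \<open>\<tau>\<close> in the decomposition of any point \<open>z\<close>.
\<close>

lemma coord_chart:
  assumes "x \<in> standard_simplex n" "j \<le> Suc N" "v \<le> Suc N"
  shows "coord v (chart j x) =
    (if v = odd_end j then x 0 else if v = even_end j then n * low x else 0)"
proof -
  have nonneg: "0 \<le> x 0" "0 \<le> n * low x"
    using assms(1) low_nonneg by (simp_all add: standard_simplex_def)
  have B: "n * low (chart j x) = x 0 * b (odd_end j) + n * low x * b (even_end j)"
    using n_real_pos by (simp add: low_chart)
  show ?thesis
  proof (cases "odd j")
    case True
    then show ?thesis
      using hat_edge [OF nonneg assms(2,3)]
      by (simp add: coord_def B chart_0 chart_Suc_n odd_end_def even_end_def)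
  next
    case False
    have "j \<noteq> succ j"
      by (simp add: succ_def)
    then show ?thesis
      using hat_edge [OF nonneg(2,1) assms(2,3)] False
      by (auto simp: coord_def B chart_0 chart_Suc_n odd_end_def even_end_def add.commute)
  qed
qed

lemma odd_succ_iff: "j \<le> Suc N \<Longrightarrow> odd (succ j) \<longleftrightarrow> even j"
  using even_N by (auto simp: succ_def)

lemma odd_odd_end: "j \<le> Suc N \<Longrightarrow> odd (odd_end j)"
  by (simp add: odd_end_def odd_succ_iff)

lemma even_even_end: "j \<le> Suc N \<Longrightarrow> even (even_end j)"
  using odd_succ_iff [of j] by (auto simp: even_end_def)

lemma end_le: "j \<le> Suc N \<Longrightarrow> odd_end j \<le> Suc N" "j \<le> Suc N \<Longrightarrow> even_end j \<le> Suc N"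
  by (auto simp: odd_end_def even_end_def succ_def)

lemma succ_eq_iff: "succ i = succ k \<longleftrightarrow> i = k"
  by (simp add: succ_def)

lemma edges_sharing_end:
  assumes "i \<le> Suc N" "k \<le> Suc N" "i \<noteq> k" "odd_end i = odd_end k \<or> even_end i = even_end k"
  shows "even i \<longleftrightarrow> odd k"
  using assms by (cases "odd i"; cases "odd k") (simp_all add: odd_end_def even_end_def succ_eq_iff)

lemma edge_eqI:
  assumes "i \<le> Suc N" "k \<le> Suc N" "odd_end i = odd_end k" "even_end i = even_end k"
  shows "i = k"
proof -
  have no_swap: "\<not> (l = succ m \<and> m = succ l)" for l m
    using N_pos by (simp add: succ_def)
  show ?thesis
    using assms no_swap [of i k]
    by (cases "odd i"; cases "odd k") (simp_all add: odd_end_def even_end_def succ_eq_iff)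
qed

context
  fixes i k :: nat and x y :: pt
  assumes ik: "i \<le> Suc N" "k \<le> Suc N"
    and x: "x \<in> standard_simplex n" and y: "y \<in> standard_simplex n"
    and eq: "chart i x = chart k y"
begin

lemma same_odd_end: "x 0 = y 0 \<and> (x 0 \<noteq> 0 \<longrightarrow> odd_end i = odd_end k)"
proof -
  have "odd_end i \<noteq> even_end k" "odd_end k \<noteq> even_end i"
    using odd_odd_end even_even_end ik by metis+
  then have 1: "x 0 = (if odd_end i = odd_end k then y 0 else 0)"
    and 2: "y 0 = (if odd_end k = odd_end i then x 0 else 0)"
    using coord_chart [OF x ik(1)] coord_chart [OF y ik(2)] end_le ik unfolding eq by metis+
  show ?thesis
  proof (cases "odd_end i = odd_end k")
    case True
    then show ?thesis
      using 1 by simp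
  next
    case False
    then show ?thesis
      using 1 2 by simp
  qed
qed

lemma same_even_end: "low x = low y \<and> (low x \<noteq> 0 \<longrightarrow> even_end i = even_end k)"
proof -
  have neq: "even_end i \<noteq> odd_end k" "even_end k \<noteq> odd_end i"
       "even_end i \<noteq> odd_end i" "even_end k \<noteq> odd_end k"
    using odd_odd_end even_even_end ik by metis+
  have 1: "n * low x = (if even_end i = even_end k then n * low y else 0)"
    and 2: "n * low y = (if even_end k = even_end i then n * low x else 0)"
    using coord_chart [OF x ik(1), of "even_end i"] coord_chart [OF y ik(2), of "even_end i"]
      coord_chart [OF x ik(1), of "even_end k"] coord_chart [OF y ik(2), of "even_end k"]
      end_le(2) [OF ik(1)] end_le(2) [OF ik(2)] neq unfolding eq by simp_all
  show ?thesis
  proof (cases "even_end i = even_end k")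
    case True
    then show ?thesis
      using 1 n_real_pos by simp
  next
    case False
    then show ?thesis
      using 1 2 n_real_pos by simp
  qed
qed

text \<open>
  The odd hats give the coordinate \<open>0\<close>, and the remainder in the cone over the boundary of \<open>\<tau>\<close> is
  visible in the image; with the minimum from the even hats this determines the other coordinates.
\<close>

lemma same_point: "x = y"
proof
  fix l
  consider "l = 0" | "l \<in> {1..n}" | "l > n"
    unfolding atLeastAtMost_iff by linarith
  then show "x l = y l"
  proof cases
    case 2
    have "x l - low x = chart i x l - low (chart i x)" "y l - low y = chart k y l - low (chart k y)"
      using 2 by (simp_all add: chart_mid low_chart)
    then show ?thesis
      using same_even_end eq by simp
  qed (use same_odd_end x y in \<open>auto simp: standard_simplex_def\<close>)
qed

end

text \<open>
  The odd end of the edge matters only for points with \<open>x 0 \<noteq> 0\<close> and the even end only for points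
  with \<open>low x \<noteq> 0\<close>. In each of these cases the edges \<open>i\<close> and \<open>k\<close> share the end in question.
\<close>

lemma chart_eq_on_face:
  assumes ik: "i \<le> Suc N" "k \<le> Suc N" and x: "x \<in> standard_simplex n"
    and eq: "chart i x = chart k x" and z: "z \<in> face_simplex (support x)"
  shows "chart i z = chart k z"
proof -
  have z': "z l = 0" if "x l = 0" for l
    using z that by (auto simp: face_simplex_def support_def)
  have "z 0 = 0 \<or> odd_end i = odd_end k"
    using same_odd_end [OF ik x x eq] z' by blast
  moreover have "low z = 0 \<or> even_end i = even_end k"
  proof (cases "low x = 0")
    case True
    then obtain l where l: "l \<in> {1..n}" "z l = 0"
      using low_attained [of x] z' by auto
    have "low z = 0"
      by (rule low_eqI [OF l(1)]) (use z l(2) in \<open>auto simp: face_simplex_def\<close>)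
    then show ?thesis ..
  next
    case False
    then show ?thesis
      using same_even_end [OF ik x x eq] by blast
  qed
  ultimately show ?thesis
    by (auto simp: chart_def)
qed

lemma pl_map_chart: "pl_map (standard_simplex n) (chart j)"
proof -
  let ?T = "\<lambda>x :: pt. x 0 *\<^sub>R corner_point (odd_end j) + base x"
  have "linear ?T"
    by (rule linearI) (auto simp: base_def fun_eq_iff algebra_simps)
  moreover have "continuous_on S ?T" for S
  proof (rule continuous_on_coordinatewise_then_product)
    have coord: "continuous_on S (\<lambda>x :: pt. x l)" for l
      by (rule continuous_on_subset [OF continuous_on_product_coordinates]) auto
    show "continuous_on S (\<lambda>x. ?T x l)" for l
      by (cases "1 \<le> l \<and> l \<le> n") (auto simp: base_def intro!: continuous_intros coord)
  qed
  ultimately show ?thesis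
    unfolding chart_def low_def standard_simplex_eq
    using n_pos by (intro pl_map_add_Min) auto
qed

sublocale glued_charts n "{..Suc N}" chart
proof
  show "i = k" if "i \<in> {..Suc N}" "k \<in> {..Suc N}" "x \<in> standard_simplex n" "support x = {..n}"
      "chart i x = chart k x" for i k x
  proof -
    have ik: "i \<le> Suc N" "k \<le> Suc N"
      using that by auto
    have nz: "x l \<noteq> 0" if "l \<le> n" for l
      using that \<open>support x = {..n}\<close> by (auto simp: support_def)
    have "low x \<noteq> 0"
      using low_attained [of x] nz by auto
    then show "i = k"
      using same_odd_end [OF ik that(3,3,5)] same_even_end [OF ik that(3,3,5)] nz edge_eqI [OF ik]
      by blast
  qed
  show "x = y" if "i \<in> {..Suc N}" "k \<in> {..Suc N}" "x \<in> standard_simplex n" "y \<in> standard_simplex n"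
      "chart i x = chart k y" for i k x y
    using that by (intro same_point [of i k x y]) simp_all
  show "chart i z = chart k z" if "i \<in> {..Suc N}" "k \<in> {..Suc N}" "x \<in> standard_simplex n"
      "chart i x = chart k x" "z \<in> face_simplex (support x)" for i k x z
    using that by (intro chart_eq_on_face [of i k x z]) simp_all
qed (simp_all add: pl_map_chart)

text \<open>
  With only one vanishing coordinate, \<open>x 0\<close> and \<open>low x\<close> are not both zero, so the two edges
  share an end.
\<close>

lemma ridge_signs:
  assumes "i \<le> Suc N" "k \<le> Suc N" "i \<noteq> k" and x: "x \<in> standard_simplex n"
    and "card (support x) = n" "chart i x = chart k x"
  shows "even i \<longleftrightarrow> odd k"
proof -
  have "x 0 \<noteq> 0 \<or> low x \<noteq> 0"
  proof (rule ccontr)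
    assume "\<not> ?thesis"
    then obtain l where l: "l \<in> {1..n}" "x l = 0" "x 0 = 0"
      using low_attained [of x] by auto
    have "support x \<subseteq> {..n}"
      using x support_subset by (simp add: standard_simplex_eq)
    then have "support x \<subseteq> {..n} - {0, l}"
      using l by (auto simp: support_def)
    then have "card (support x) \<le> card ({..n} - {0, l})"
      by (intro card_mono) auto
    also have "\<dots> = Suc n - 2"
      using l by (subst card_Diff_subset) auto
    finally have "n \<le> Suc n - 2"
      unfolding assms(5) .
    then show False
      using n_pos by linarith
  qed
  then have "odd_end i = odd_end k \<or> even_end i = even_end k"
    using same_odd_end [OF assms(1,2) x x assms(6)] same_even_end [OF assms(1,2) x x assms(6)] by argo
  then show ?thesis
    by (rule edges_sharing_end [OF assms(1-3)])
qed

lemma ex_step: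
  assumes "0 \<le> r" "r \<le> real m * s" "0 < m"
  shows "\<exists>j<m. real j * s \<le> r \<and> r \<le> real (Suc j) * s"
  using assms
proof (induction m)
  case (Suc m)
  show ?case
  proof (cases "0 < m \<and> r \<le> real m * s")
    case True
    then show ?thesis
      using Suc by (metis less_Suc_eq)
  next
    case False
    then show ?thesis
      using Suc.prems by (intro exI [of _ m]) auto
  qed
qed simp

text \<open>
  The condition on \<open>A\<close>, \<open>B\<close>, \<open>C\<close> describes the cone over the boundary of the triangle.
\<close>

lemma polygon_covers:
  assumes "0 \<le> A" "0 \<le> B" "0 \<le> C" "A = 0 \<or> B = 0 \<or> C = 0"
  obtains j \<alpha> \<beta> where "j \<le> Suc N" "0 \<le> \<alpha>" "0 \<le> \<beta>"
    "A = \<alpha> * a (odd_end j) + \<beta> * a (even_end j)"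
    "B = \<alpha> * b (odd_end j) + \<beta> * b (even_end j)"
    "C = \<alpha> * c (odd_end j) + \<beta> * c (even_end j)"
proof -
  have N: "0 < real N"
    using N_pos by simp
  have "\<exists>j \<gamma> \<delta>. j \<le> Suc N \<and> 0 \<le> \<gamma> \<and> 0 \<le> \<delta> \<and> A = \<gamma> * a j + \<delta> * a (succ j)
      \<and> B = \<gamma> * b j + \<delta> * b (succ j) \<and> C = \<gamma> * c j + \<delta> * c (succ j)"
  proof -
    consider "C = 0" | "B = 0" | "A = 0"
      using assms(4) by blast
    then show ?thesis
    proof cases
      case 1
      define s where "s = A + B"
      have "N * A \<le> N * s"
        using assms(2) by (intro mult_left_mono) (simp_all add: s_def)
      then obtain j where j: "j < N" "j * s \<le> N * A" "N * A \<le> Suc j * s"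
        using ex_step [of "N * A" N s] assms(1) N_pos by auto
      \<comment> \<open>Barycentric coordinates on the edge, which has length \<open>s / N\<close>, scaled to the sum \<open>s\<close>.\<close>
      define \<gamma> \<delta> where "\<gamma> = Suc j * s - N * A" and "\<delta> = N * A - j * s"
      have "N * A = \<gamma> * j + \<delta> * (j + 1)" and sum: "\<gamma> + \<delta> = s"
        by (simp_all add: \<gamma>_def \<delta>_def algebra_simps)
      then have A: "A = \<gamma> * (j / N) + \<delta> * ((j + 1) / N)"
        using N by (simp add: field_simps)
      have "B = \<gamma> * (1 - j / N) + \<delta> * (1 - (j + 1) / N)"
      proof -
        have "B = (\<gamma> + \<delta>) - A"
          using sum by (simp add: s_def)
        then show ?thesis
          by (subst (asm) A) (simp add: algebra_simps)
      qed
      with A show ?thesis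
        using 1 j by (intro exI [of _ j] exI [of _ \<gamma>] exI [of _ \<delta>])
          (auto simp: a_def b_def c_def succ_def \<gamma>_def \<delta>_def algebra_simps)
    next
      case 2
      then show ?thesis
        using assms N by (intro exI [of _ N] exI [of _ A] exI [of _ C])
          (auto simp: a_def b_def c_def succ_def)
    next
      case 3
      then show ?thesis
        using assms N by (intro exI [of _ "Suc N"] exI [of _ C] exI [of _ B])
          (auto simp: a_def b_def c_def succ_def)
    qed
  qed
  then obtain j \<gamma> \<delta> where j: "j \<le> Suc N" "0 \<le> \<gamma>" "0 \<le> \<delta>" "A = \<gamma> * a j + \<delta> * a (succ j)"
    "B = \<gamma> * b j + \<delta> * b (succ j)" "C = \<gamma> * c j + \<delta> * c (succ j)"
    by blast
  show ?thesis
  proof (cases "odd j")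
    case True
    then show ?thesis
      using that [OF j(1-3)] j(4-6) by (simp add: odd_end_def even_end_def)
  next
    case False
    then show ?thesis
      using that [OF j(1,3,2)] j(4-6) by (simp add: odd_end_def even_end_def add.commute)
  qed
qed

lemma sum_split: "sum g {..Suc n} = g 0 + sum g {1..n} + g (Suc n)" for g :: "nat \<Rightarrow> real"
proof -
  have "sum g {..n} = g 0 + sum g {1..n}"
    by (simp add: sum.atMost_shift sum.atLeast1_atMost_eq)
  then show ?thesis
    by simp
qed

lemma pl_sphere_eq: "pl_sphere n = {z \<in> face_simplex {..Suc n}. \<exists>i\<le>Suc n. z i = 0}"
  by (simp add: pl_sphere_def standard_simplex_eq)

lemma simplex_sum: "x \<in> standard_simplex n \<Longrightarrow> x 0 + sum x {1..n} = 1"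
  using sum_split [of x] by (simp add: standard_simplex_def)

lemma chart_in_sphere:
  assumes x: "x \<in> standard_simplex n" and j: "j \<le> Suc N"
  shows "chart j x \<in> pl_sphere n"
proof -
  let ?z = "chart j x" and ?o = "odd_end j" and ?e = "even_end j"
  have nonneg: "0 \<le> x 0" "0 \<le> low x"
    using x low_nonneg by (auto simp: standard_simplex_def)
  have "0 \<le> ?z i" for i
  proof -
    consider "i = 0" | "i \<in> {1..n}" | "i = Suc n" | "i > Suc n"
      unfolding atLeastAtMost_iff by linarith
    then show ?thesis
      by cases (use nonneg low_le [of i x] in \<open>auto simp: chart_0 chart_mid chart_Suc_n chart_outside\<close>)
  qed
  moreover have "sum ?z {..Suc n} = 1"
  proof -
    have "sum ?z {1..n} = sum x {1..n} - n * low x + (x 0 * b ?o + n * low x * b ?e)"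
    proof -
      have "sum ?z {1..n} = (\<Sum>i=1..n. x i - low x + (x 0 * b ?o + n * low x * b ?e) / n)"
        by (intro sum.cong) (simp_all add: chart_mid)
      then show ?thesis
        using n_real_pos by (simp add: sum.distrib sum_subtractf)
    qed
    then have "sum ?z {..Suc n} = x 0 * (a ?o + b ?o + c ?o) + n * low x * (a ?e + b ?e + c ?e)
        + sum x {1..n} - n * low x"
      unfolding sum_split chart_0 chart_Suc_n by (simp add: algebra_simps)
    then show ?thesis
      using simplex_sum [OF x] by (simp add: abc_sum)
  qed
  moreover have "\<exists>i\<le>Suc n. ?z i = 0"
  proof -
    obtain i where i: "i \<in> {1..n}" "x i = low x"
      using low_attained by blast
    consider "j < N" | "j = N" | "j = Suc N"
      using j by linarith
    then show ?thesis
    proof cases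
      case 1
      then have "?z (Suc n) = 0"
        by (auto simp: chart_Suc_n odd_end_def even_end_def c_def succ_def)
      then show ?thesis
        by blast
    next
      case 2
      then have "?z i = 0"
        using i N_pos by (auto simp: chart_mid odd_end_def even_end_def b_def succ_def)
      then show ?thesis
        using i by (intro exI [of _ i]) auto
    next
      case 3
      then have "?z 0 = 0"
        by (auto simp: chart_0 odd_end_def even_end_def a_def succ_def)
      then show ?thesis
        by blast
    qed
  qed
  ultimately show ?thesis
    by (auto simp: pl_sphere_eq face_simplex_def chart_outside)
qed

text \<open>
  Some coordinate of \<open>z\<close> vanishes, so its component in the span of the triangle lies over the
  boundary of the triangle, hence over an edge of the polygon.
\<close>

lemma sphere_covered:
  assumes "z \<in> pl_sphere n"
  obtains j x where "j \<le> Suc N" "x \<in> standard_simplex n" "z = chart j x"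
proof -
  have z0: "0 \<le> z i" for i
    using assms by (simp add: pl_sphere_eq face_simplex_def)
  have zout: "z i = 0" if "i > Suc n" for i
    using assms that by (simp add: pl_sphere_eq face_simplex_def)
  have zsum: "z 0 + sum z {1..n} + z (Suc n) = 1"
    using assms sum_split [of z] by (simp add: pl_sphere_eq face_simplex_def)
  have low0: "0 \<le> low z"
    using low_attained [of z] z0 by metis
  have "z 0 = 0 \<or> n * low z = 0 \<or> z (Suc n) = 0"
  proof -
    obtain i where i: "i \<le> Suc n" "z i = 0"
      using assms by (auto simp: pl_sphere_eq)
    consider "i = 0" | "i \<in> {1..n}" | "i = Suc n"
      using i(1) unfolding atLeastAtMost_iff by linarith
    then show ?thesis
    proof cases
      case 2
      then show ?thesis
        using low_le [of i z] i(2) low0 by simp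
    qed (use i in auto)
  qed
  then obtain j \<alpha> \<beta> where j: "j \<le> Suc N" "0 \<le> \<alpha>" "0 \<le> \<beta>"
    "z 0 = \<alpha> * a (odd_end j) + \<beta> * a (even_end j)"
    "n * low z = \<alpha> * b (odd_end j) + \<beta> * b (even_end j)"
    "z (Suc n) = \<alpha> * c (odd_end j) + \<beta> * c (even_end j)"
    using polygon_covers [of "z 0" "n * low z" "z (Suc n)"] z0 low0 by auto
  define x :: pt where
    "x = (\<lambda>i. if i = 0 then \<alpha> else if i \<le> n then z i - low z + \<beta> / n else 0)"
  have "\<alpha> * (a (odd_end j) + b (odd_end j) + c (odd_end j)) +
      \<beta> * (a (even_end j) + b (even_end j) + c (even_end j)) = z 0 + n * low z + z (Suc n)"
    using j(4-6) by (simp add: algebra_simps)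
  then have ab: "\<alpha> + \<beta> = z 0 + n * low z + z (Suc n)"
    by (simp add: abc_sum)
  have "sum x {1..n} = sum z {1..n} - n * low z + \<beta>"
  proof -
    have "sum x {1..n} = (\<Sum>i=1..n. z i - low z + \<beta> / n)"
      by (intro sum.cong) (auto simp: x_def)
    then show ?thesis
      using n_real_pos by (simp add: sum.distrib sum_subtractf)
  qed
  then have "sum x {..n} = 1"
    using ab zsum sum_split [of x] by (simp add: x_def)
  moreover have "0 \<le> x i" for i
    using j(2,3) low_le [of i z] by (auto simp: x_def)
  ultimately have x: "x \<in> standard_simplex n"
    by (auto simp: standard_simplex_eq face_simplex_def x_def)
  have lowx: "low x = \<beta> / n"
  proof -
    obtain i where i: "i \<in> {1..n}" "z i = low z"
      using low_attained by blast
    show ?thesis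
      by (rule low_eqI [OF i(1)]) (use i low_le in \<open>auto simp: x_def\<close>)
  qed
  then have nlow: "n * low x = \<beta>"
    using n_real_pos by simp
  have lz: "low z = (\<alpha> * b (odd_end j) + \<beta> * b (even_end j)) / n"
    using j(5) n_real_pos by (simp add: field_simps)
  have x0: "x 0 = \<alpha>"
    by (simp add: x_def)
  have "z = chart j x"
  proof
    fix i
    consider "i = 0" | "i \<in> {1..n}" | "i = Suc n" | "i > Suc n"
      unfolding atLeastAtMost_iff by linarith
    then show "z i = chart j x i"
    proof cases
      case 2
      have "chart j x i = x i - low x + low z"
        unfolding chart_mid [OF 2] nlow x0 lz ..
      then show ?thesis
        using 2 lowx by (simp add: x_def)
    qed (simp_all add: chart_0 chart_Suc_n chart_outside nlow x0 j(4,6) zout)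
  qed
  then show ?thesis
    using that j(1) x by blast
qed

lemma Union_cells_sphere: "\<Union>cells = pl_sphere n"
proof (intro equalityI subsetI)
  fix z assume "z \<in> \<Union>cells"
  then show "z \<in> pl_sphere n"
    unfolding Union_cells using chart_in_sphere by auto
next
  fix z assume "z \<in> pl_sphere n"
  then obtain j x where "j \<le> Suc N" "x \<in> standard_simplex n" "z = chart j x"
    by (rule sphere_covered)
  then show "z \<in> \<Union>cells"
    unfolding Union_cells by blast
qed

end

section \<open>Maps of every degree\<close>

lemma pl_homeomorphic_sphere: "pl_homeomorphic (pl_sphere n) (pl_sphere n)"
proof -
  let ?P = "(\<lambda>i. face_simplex ({..Suc n} - {i})) ` {..Suc n}"
  have "face_simplex ({..Suc n} - {i}) = {z \<in> face_simplex {..Suc n}. z i = 0}" if "i \<le> Suc n" for i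
    using that by (subst face_simplex_Int [of _ "{..Suc n}"]) (auto simp: face_simplex_def)
  then have union: "pl_sphere n = \<Union>?P"
    by (auto simp: pl_sphere_def standard_simplex_eq)
  have "pl_map (pl_sphere n) (\<lambda>x. x)"
    unfolding pl_map_alt using union
    by (intro conjI continuous_on_id exI [of _ ?P]) (auto simp: affine_on_def)
  moreover have "compact (pl_sphere n)"
    unfolding union by (intro compact_Union) (auto simp: compact_face_simplex)
  ultimately have "pl_homeomorphism (pl_sphere n) ((\<lambda>x. x) ` pl_sphere n) (\<lambda>x. x)"
    by (intro pl_homeomorphism_onto_image) auto
  then show ?thesis
    by (auto simp: pl_homeomorphic_def)
qed

lemma card_parity_below: 
  "card {j. j < 2 * k \<and> even j} = k" "card {j. j < 2 * k \<and> odd j} = k" for k :: nat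
proof -
  have "{j. j < 2 * k \<and> even j} = (\<lambda>i. 2 * i) ` {..<k}" "{j. j < 2 * k \<and> odd j} = (\<lambda>i. 2 * i + 1) ` {..<k}"
    by (auto elim!: evenE oddE) presburger
  then show "card {j. j < 2 * k \<and> even j} = k" "card {j. j < 2 * k \<and> odd j} = k"
    by (simp_all add: card_image inj_on_def)
qed

text \<open>
  The polygon has \<open>2 * \<bar>d\<bar> + 4\<close> edges, the even ones being positive. The \<open>\<bar>d\<bar>\<close> first edges of
  the sign of \<open>d\<close> are sent to the standard simplex.
\<close>

lemma ex_degree:
  assumes "n \<ge> 1"
  shows "\<exists>K c P f. oriented_colored_triangulation n (pl_sphere n) K c P \<and>
    simplicial_map K (std_complex n) f \<and>
    has_degree n K c P (std_complex n) std_color (std_positive n) f d"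
proof -
  define k where "k = nat \<bar>d\<bar>"
  interpret polygon n "2 * k + 2"
    using assms by unfold_locales auto
  let ?I = "{..Suc (2 * k + 2)}"
  define T where "T = {j \<in> ?I. even j}"
  define S where "S = {j. j < 2 * k \<and> (even j \<longleftrightarrow> 0 \<le> d)}"
  have lt: "j \<le> Suc (2 * k + 2) \<longleftrightarrow> j < 2 * (k + 2)" for j
    by auto
  have "oriented_colored_triangulation n (pl_sphere n) cells color (facet ` T)"
  proof (rule oriented_colored_triangulation_cells [OF assms])
    show "T \<subseteq> ?I"
      by (auto simp: T_def)
    show "pl_homeomorphic (\<Union>cells) (pl_sphere n)"
      unfolding Union_cells_sphere by (rule pl_homeomorphic_sphere)
    show "i \<in> T \<longleftrightarrow> k \<notin> T" if "i \<in> ?I" "k \<in> ?I" "i \<noteq> k" "x \<in> standard_simplex n"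
        "card (support x) = n" "chart i x = chart k x" for i k x
      using ridge_signs [of i k x] that by (simp add: T_def)
  qed
  moreover have "has_degree n cells color (facet ` T) (std_complex n) std_color (std_positive n)
      (fold_map S) (int (card (T \<inter> S)) - int (card (S - T)))"
  proof (rule has_degree_fold_map [OF assms])
    have "T = {j. j < 2 * (k + 2) \<and> even j}" "?I - T = {j. j < 2 * (k + 2) \<and> odd j}"
      using lt by (auto simp: T_def)
    then show "card T = card (?I - T)"
      using card_parity_below by presburger
  qed (auto simp: T_def S_def)
  moreover have "int (card (T \<inter> S)) - int (card (S - T)) = d"
  proof (cases "0 \<le> d")
    case True
    then have "T \<inter> S = {j. j < 2 * k \<and> even j}" "S - T = {}"
      by (auto simp: T_def S_def)
    then have "card (T \<inter> S) = k" "card (S - T) = 0"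
      by (simp_all only: card_parity_below card.empty)
    then show ?thesis
      using True by (simp add: k_def)
  next
    case False
    then have "T \<inter> S = {}" "S - T = {j. j < 2 * k \<and> odd j}"
      by (auto simp: T_def S_def)
    then have "card (T \<inter> S) = 0" "card (S - T) = k"
      by (simp_all only: card_parity_below card.empty)
    then show ?thesis
      using False by (simp add: k_def)
  qed
  ultimately show ?thesis
    using simplicial_map_fold_map by metis
qed

theorem corollary12:
  fixes n :: nat and d :: int
  assumes "n \<ge> 1"
  shows "\<exists>K c P f.
           oriented_colored_triangulation n (pl_sphere n) K c P \<and>
           simplicial_map K (std_complex n) f \<and>
           has_degree n K c P (std_complex n) std_color (std_positive n) f d \<and>
           \<not> (\<exists>K' c' P' f'.
                oriented_colored_triangulation n (pl_sphere n) K' c' P' \<and>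
                card (facets K') < card (facets K) \<and>
                simplicial_map K' (std_complex n) f' \<and>
                has_degree n K' c' P' (std_complex n) std_color (std_positive n) f' d)"
proof -
  let ?Q = "\<lambda>K. \<exists>c P f. oriented_colored_triangulation n (pl_sphere n) K c P \<and>
    simplicial_map K (std_complex n) f \<and>
    has_degree n K c P (std_complex n) std_color (std_positive n) f d"
  obtain K where K: "?Q K" "\<And>K'. ?Q K' \<Longrightarrow> card (facets K) \<le> card (facets K')"
    using ex_has_least_nat [of ?Q _ "\<lambda>K. card (facets K)"] ex_degree [OF assms, of d] by blast
  then obtain c P f where "oriented_colored_triangulation n (pl_sphere n) K c P"
    "simplicial_map K (std_complex n) f"
    "has_degree n K c P (std_complex n) std_color (std_positive n) f d"
    by blast
  moreover have "\<not> (\<exists>K' c' P' f'.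
                oriented_colored_triangulation n (pl_sphere n) K' c' P' \<and>
                card (facets K') < card (facets K) \<and>
                simplicial_map K' (std_complex n) f' \<and>
                has_degree n K' c' P' (std_complex n) std_color (std_positive n) f' d)"
    using K(2) by (meson not_less)
  ultimately show ?thesis
    by blast
qed

end
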